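(* Let $T$ be a non-star tree and let $x$ be any vertex of $T$. Then there exists a $(T,x)$-well 2-placement.
   Context: All graphs are finite, simple and undirected; $dist$ denotes distance in $T$ and $d(y)$ the degree of $y$ in $T$. A non-star tree is a tree that is not isomorphic to a star $K_{1,m}$ for any $m\ge 0$ (so it has at least $4$ vertices). A permutation $\sigma$ of $V(T)$ is a 2-placement of $T$ if for every edge $ab\in E(T)$, $\sigma(a)\sigma(b)\notin E(T)$. $T^k$ denotes the $k$-th power of $T$; $\sigma(T)\subseteq T^k$ means that for every edge $ab$ of $T$, $dist(\sigma(a),\sigma(b))\le k$. Cycles of $\sigma$ are those of its disjoint cycle decomposition. For a non-star tree $T$ and a vertex $x$, a fixed-point-free permutation $\sigma$ of $V(T)$ is a $(T,x)$-well 2-placement if: (1) $\sigma$ is a 2-placement of $T$; (2) $\sigma(T)\subseteq T^6$; (3) $dist(x,\sigma(x))\le 2$; (4) $dist(y,\sigma(y))\le 3$ for every neighbor $y$ of $x$; (5) $dist(y,\sigma(y))\le 4$ for every $y$ with $d(y)=1$; (6) every cycle of $\sigma$ has length at most $5$. *)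

theory Defs
  imports Main
begin

text \<open>A finite simple graph is given by a vertex set V and a symmetric irreflexive
  edge relation E on V.\<close>

definition simple_graph :: "'a set \<Rightarrow> 'a rel \<Rightarrow> bool" where
  "simple_graph V E \<longleftrightarrow> finite V \<and> E \<subseteq> V \<times> V \<and> sym E \<and> irrefl E"

definition connected_graph :: "'a set \<Rightarrow> 'a rel \<Rightarrow> bool" where
  "connected_graph V E \<longleftrightarrow> (\<forall>u\<in>V. \<forall>v\<in>V. (u, v) \<in> E\<^sup>*)"

text \<open>A cycle: a list of at least 3 distinct vertices, consecutive ones adjacent,
  and the last adjacent to the first.\<close>

definition is_cycle :: "'a rel \<Rightarrow> 'a list \<Rightarrow> bool" where
  "is_cycle E cs \<longleftrightarrow> length cs \<ge> 3 \<and> distinct cs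
     \<and> (\<forall>i < length cs - 1. (cs ! i, cs ! Suc i) \<in> E)
     \<and> (last cs, hd cs) \<in> E"

definition is_tree :: "'a set \<Rightarrow> 'a rel \<Rightarrow> bool" where
  "is_tree V E \<longleftrightarrow> simple_graph V E \<and> V \<noteq> {} \<and> connected_graph V E
     \<and> \<not> (\<exists>cs. is_cycle E cs)"

text \<open>The graph is (isomorphic to) a star K_{1,m}: there is a centre c such that
  the edges are exactly the pairs of distinct vertices one of which is c.\<close>

definition is_star :: "'a set \<Rightarrow> 'a rel \<Rightarrow> bool" where
  "is_star V E \<longleftrightarrow> (\<exists>c\<in>V. E = {(u, v). u \<in> V \<and> v \<in> V \<and> u \<noteq> v \<and> (u = c \<or> v = c)})"

text \<open>Distance: length of a shortest path (number of edges).\<close>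

definition gdist :: "'a rel \<Rightarrow> 'a \<Rightarrow> 'a \<Rightarrow> nat" where
  "gdist E u v = (LEAST n. (u, v) \<in> E ^^ n)"

definition degree :: "'a rel \<Rightarrow> 'a \<Rightarrow> nat" where
  "degree E v = card {w. (v, w) \<in> E}"

text \<open>Permutation of V (identity outside V).\<close>

definition perm_on :: "'a set \<Rightarrow> ('a \<Rightarrow> 'a) \<Rightarrow> bool" where
  "perm_on V \<sigma> \<longleftrightarrow> bij_betw \<sigma> V V \<and> (\<forall>v. v \<notin> V \<longrightarrow> \<sigma> v = v)"

definition two_placement :: "'a set \<Rightarrow> 'a rel \<Rightarrow> ('a \<Rightarrow> 'a) \<Rightarrow> bool" where
  "two_placement V E \<sigma> \<longleftrightarrow> perm_on V \<sigma> \<and> (\<forall>(a, b) \<in> E. (\<sigma> a, \<sigma> b) \<notin> E)"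

text \<open>Every cycle of \<sigma> (on V) has length at most k: each vertex returns to itself
  after some number of steps between 1 and k.\<close>

definition cycles_at_most :: "'a set \<Rightarrow> ('a \<Rightarrow> 'a) \<Rightarrow> nat \<Rightarrow> bool" where
  "cycles_at_most V \<sigma> k \<longleftrightarrow> (\<forall>v\<in>V. \<exists>j. 1 \<le> j \<and> j \<le> k \<and> (\<sigma> ^^ j) v = v)"

definition well_2_placement :: "'a set \<Rightarrow> 'a rel \<Rightarrow> 'a \<Rightarrow> ('a \<Rightarrow> 'a) \<Rightarrow> bool" where
  "well_2_placement V E x \<sigma> \<longleftrightarrow>
     perm_on V \<sigma>
   \<and> (\<forall>v\<in>V. \<sigma> v \<noteq> v)
   \<and> two_placement V E \<sigma>
   \<and> (\<forall>(a, b) \<in> E. gdist E (\<sigma> a) (\<sigma> b) \<le> 6)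
   \<and> gdist E x (\<sigma> x) \<le> 2
   \<and> (\<forall>y. (x, y) \<in> E \<longrightarrow> gdist E y (\<sigma> y) \<le> 3)
   \<and> (\<forall>y\<in>V. degree E y = 1 \<longrightarrow> gdist E y (\<sigma> y) \<le> 4)
   \<and> cycles_at_most V \<sigma> 5"

end

theory Submission
  imports Defs "HOL-Library.Multiset"
begin

text \<open>By induction on the number of vertices we prove slightly more: every vertex, not only a
  leaf, is moved by at most 4. Then two leaves at the same vertex can be removed from the tree,
  unless this leaves a star, and interchanged afterwards; similarly two legs (pendant paths with at most three
  vertices) at the same vertex, or one pendant path with four vertices, can be permuted among
  themselves, since the edge joining them to the rest stays short enough.

  In a tree without twin leaves, take an edge \<open>ab\<close> with \<open>x\<close> on the side \<open>A\<close> of \<open>a\<close> such that the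
  side \<open>B\<close> of \<open>b\<close> is not a star and is as small as possible. All branches of \<open>B\<close> at \<open>b\<close> are
  stars without twins, so \<open>B\<close> is a spider with legs of at most three vertices. If \<open>A\<close> is not
  a star, two legs at \<open>b\<close>, or all of \<open>B\<close> when it has only one leg, can be removed.
  Otherwise \<open>A\<close> is a leg too and the whole tree is a spider; the same holds around \<open>x\<close> when there
  is no such edge. From a spider two legs can be removed unless it is one of nine small ones.\<close>

section \<open>Extending a placement\<close>

text \<open>Only upper bounds on distances are required. A walk of bounded length survives enlarging
  the edge set and can be composed with another, so no shortest walk ever has to be
  determined.\<close>

definition near :: "'a rel \<Rightarrow> nat \<Rightarrow> 'a \<Rightarrow> 'a \<Rightarrow> bool" where
  "near E k u v \<longleftrightarrow> (\<exists>j\<le>k. (u, v) \<in> E ^^ j)"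

lemma near_refl [simp]: "near E k u u"
  unfolding near_def by (rule exI[of _ 0]) simp

lemma near_mono: "near E k u v \<Longrightarrow> E \<subseteq> F \<Longrightarrow> k \<le> l \<Longrightarrow> near F l u v"
proof -
  assume *: "near E k u v" "E \<subseteq> F" "k \<le> l"
  have "(u, v) \<in> E ^^ j \<Longrightarrow> (u, v) \<in> F ^^ j" for j
    by (induction j arbitrary: v) (use *(2) in auto)
  with * show ?thesis unfolding near_def by (meson order_trans)
qed

lemma near_trans: "near E k u v \<Longrightarrow> near E l v w \<Longrightarrow> near E (k + l) u w"
  unfolding near_def by (meson add_mono relpow_trans)

lemma near_edge: "(u, v) \<in> E \<Longrightarrow> near E (Suc 0) u v"
  unfolding near_def by (rule exI[of _ 1]) simp

lemma near_sym:
  assumes "sym E" "near E k u v" shows "near E k v u"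
proof -
  have "(u, v) \<in> E ^^ j \<Longrightarrow> (v, u) \<in> E ^^ j" for j
  proof (induction j arbitrary: v)
    case (Suc j)
    then obtain w where "(u, w) \<in> E ^^ j" "(w, v) \<in> E" by auto
    with Suc.IH assms(1) show ?case by (meson relpow_Suc_I2 symD)
  qed simp
  with assms(2) show ?thesis unfolding near_def by blast
qed

lemma gdist_le_of_near: "near E k u v \<Longrightarrow> gdist E u v \<le> k"
  unfolding near_def gdist_def by (meson Least_le order_trans)

section \<open>Placements, the invariant of the induction\<close>

definition short_cycle :: "('a \<Rightarrow> 'a) \<Rightarrow> 'a \<Rightarrow> bool" where
  "short_cycle \<sigma> v \<longleftrightarrow> (\<exists>j\<in>{1..5}. (\<sigma> ^^ j) v = v)"

text \<open>The bound 4 is imposed on every vertex because any vertex may become an attachment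
  vertex in the induction. Values outside \<open>V\<close> are left open, so that maps on disjoint
  parts can be glued; the identity is put there only in
  \<open>well_2_placement_of_placement\<close>.\<close>

definition placement :: "'a set \<Rightarrow> 'a rel \<Rightarrow> 'a \<Rightarrow> ('a \<Rightarrow> 'a) \<Rightarrow> bool" where
  "placement V E x \<sigma> \<longleftrightarrow>
     bij_betw \<sigma> V V
   \<and> (\<forall>v\<in>V. \<sigma> v \<noteq> v \<and> near E 4 v (\<sigma> v) \<and> short_cycle \<sigma> v)
   \<and> (\<forall>(a, b)\<in>E. (\<sigma> a, \<sigma> b) \<notin> E \<and> near E 6 (\<sigma> a) (\<sigma> b))
   \<and> near E 2 x (\<sigma> x)
   \<and> (\<forall>y. (x, y) \<in> E \<longrightarrow> near E 3 y (\<sigma> y))"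

lemma funpow_cong_on:
  assumes "\<And>v. v \<in> R \<Longrightarrow> f v = g v \<and> g v \<in> R" "v \<in> R"
  shows "(f ^^ j) v = (g ^^ j) v \<and> (g ^^ j) v \<in> R"
  by (induction j) (use assms in auto)

lemma short_cycle_cong_on:
  assumes "\<And>v. v \<in> R \<Longrightarrow> f v = g v \<and> g v \<in> R" "v \<in> R" "short_cycle g v"
  shows "short_cycle f v"
  using funpow_cong_on[of R f g, OF assms(1,2)] assms(3) unfolding short_cycle_def by metis

lemma well_2_placement_of_placement:
  assumes "placement V E x \<sigma>" "E \<subseteq> V \<times> V" "x \<in> V"
  shows "\<exists>\<sigma>. well_2_placement V E x \<sigma>"
proof -
  let ?f = "\<lambda>v. if v \<in> V then \<sigma> v else v"
  note * = assms(1)[unfolded placement_def]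
  have bij: "bij_betw ?f V V"
    using * bij_betw_cong[of V ?f \<sigma> V] by simp
  have inV: "\<sigma> v \<in> V" if "v \<in> V" for v using * that bij_betwE by metis
  have "perm_on V ?f" unfolding perm_on_def using bij by simp
  moreover have "\<exists>j. 1 \<le> j \<and> j \<le> 5 \<and> (?f ^^ j) v = v" if "v \<in> V" for v
  proof -
    have "short_cycle ?f v"
      by (rule short_cycle_cong_on[of V _ \<sigma>]) (use * that inV in auto)
    then show ?thesis by (auto simp: short_cycle_def)
  qed
  moreover have "gdist E y (\<sigma> y) \<le> 3" if "(x, y) \<in> E" for y
    using * that by (blast intro: gdist_le_of_near)
  moreover have "a \<in> V \<and> b \<in> V \<and> (\<sigma> a, \<sigma> b) \<notin> E \<and> gdist E (\<sigma> a) (\<sigma> b) \<le> 6" if "(a, b) \<in> E" for a b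
    using * that assms(2) by (blast intro: gdist_le_of_near)
  ultimately have "well_2_placement V E x ?f"
    unfolding well_2_placement_def two_placement_def cycles_at_most_def
    using * assms(2,3) by (auto intro!: gdist_le_of_near split: if_splits)
  then show ?thesis by blast
qed

text \<open>An edge \<open>cb\<close> from the attachment vertex \<open>c\<close> into \<open>R\<close> is mapped to a non-edge merely because
  \<open>\<sigma>' c \<noteq> c\<close>. The case \<open>A = {}\<close>, \<open>c \<in> R\<close> serves to place a tree from scratch.\<close>

lemma placement_extend:
  assumes EA: "EA \<subseteq> A \<times> A" and ER: "ER \<subseteq> insert c R \<times> insert c R" "sym ER" "(c, c) \<notin> ER"
    and disj: "A \<inter> R = {}"
    and A: "placement A EA x' \<sigma>'"
    and R: "bij_betw \<tau> R R" "\<And>y. y \<in> R \<Longrightarrow> \<tau> y \<noteq> y \<and> near ER 4 y (\<tau> y) \<and> short_cycle \<tau> y"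
    and RE: "\<And>a b. (a, b) \<in> ER \<Longrightarrow> a \<in> R \<Longrightarrow> b \<in> R \<Longrightarrow> (\<tau> a, \<tau> b) \<notin> ER \<and> near ER 6 (\<tau> a) (\<tau> b)"
    and c: "c \<notin> R \<Longrightarrow> c \<in> A"
    and cn: "\<And>b. c \<notin> R \<Longrightarrow> (c, b) \<in> ER \<Longrightarrow> near ER k c (\<tau> b) \<and> near EA l c (\<sigma>' c)" "k + l \<le> 6"
    and x: "x \<in> A \<and> x' = x \<and> (\<forall>b. (c, b) \<in> ER \<longrightarrow> b \<in> R \<longrightarrow> x = c \<longrightarrow> near ER 3 b (\<tau> b))
      \<or> x \<in> R \<and> near ER 2 x (\<tau> x) \<and> (\<forall>b\<in>R. (x, b) \<in> ER \<longrightarrow> near ER 3 b (\<tau> b)) \<and> (c \<notin> R \<longrightarrow> x' = c)"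
    and symA: "sym EA"
  shows "\<exists>\<sigma>. placement (A \<union> R) (EA \<union> ER) x \<sigma>"
proof -
  let ?E = "EA \<union> ER"
  define \<sigma> where "\<sigma> v = (if v \<in> R then \<tau> v else \<sigma>' v)" for v
  note A' = A[unfolded placement_def]
  have sE: "sym ?E" using ER(2) symA by (rule sym_Un[rotated])
  have sR: "v \<in> R \<Longrightarrow> \<sigma> v = \<tau> v" and sA: "v \<in> A \<Longrightarrow> \<sigma> v = \<sigma>' v" for v
    using disj by (auto simp: \<sigma>_def)
  have tR: "v \<in> R \<Longrightarrow> \<tau> v \<in> R" for v using R(1) bij_betwE by metis
  have tA: "v \<in> A \<Longrightarrow> \<sigma>' v \<in> A" for v using A' bij_betwE by metis
  have mA: "near EA i u v \<Longrightarrow> i \<le> j \<Longrightarrow> near ?E j u v" for i j u v by (rule near_mono) auto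
  have mX: "near ER i u v \<Longrightarrow> i \<le> j \<Longrightarrow> near ?E j u v" for i j u v by (rule near_mono) auto
  have bA: "bij_betw \<sigma> A A" using A' bij_betw_cong[of A \<sigma> \<sigma>' A] by (simp add: sA)
  have bR: "bij_betw \<sigma> R R" using R(1) bij_betw_cong[of R \<sigma> \<tau> R] by (simp add: sR)
  have 1: "bij_betw \<sigma> (A \<union> R) (A \<union> R)" by (rule bij_betw_combine[OF bA bR disj])
  have 2: "\<sigma> v \<noteq> v \<and> near ?E 4 v (\<sigma> v) \<and> short_cycle \<sigma> v" if "v \<in> A \<union> R" for v
  proof (cases "v \<in> R")
    case True
    then show ?thesis using R(2)[OF True] sR tR short_cycle_cong_on[of R \<sigma> \<tau> v] mX by auto
  next
    case False
    then have v: "v \<in> A" using that by blast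
    then show ?thesis using A' sA tA short_cycle_cong_on[of A \<sigma> \<sigma>' v] mA by auto
  qed
  have cross: "(\<sigma> c, \<sigma> b) \<notin> ?E \<and> near ?E 6 (\<sigma> c) (\<sigma> b)"
    if "(c, b) \<in> ER" "c \<notin> R" for b
  proof -
    have cA: "c \<in> A" using c that by blast
    have b: "b \<in> R" using that ER by auto
    have "\<sigma>' c \<noteq> c" "\<sigma>' c \<in> A" "\<tau> b \<in> R" using A' cA tA tR b by auto
    then have "(\<sigma>' c, \<tau> b) \<notin> ?E" using EA ER disj by auto
    \<comment> \<open>The walk passes through \<open>c\<close>: at most \<open>l\<close> steps back
      from \<open>\<sigma>' c\<close>, then at most \<open>k\<close> steps on to
      \<open>\<tau> b\<close>.\<close>
    moreover have "near ?E (l + k) (\<sigma>' c) (\<tau> b)"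
      using cn(1)[OF that(2,1)] near_sym[OF sE] mA mX near_trans by (metis order_refl)
    ultimately show ?thesis using cA b sA sR cn(2) near_mono[of ?E "l + k" _ _ ?E 6] by auto
  qed
  have 3: "(\<sigma> a, \<sigma> b) \<notin> ?E \<and> near ?E 6 (\<sigma> a) (\<sigma> b)" if "(a, b) \<in> ?E" for a b
  proof (cases "(a, b) \<in> EA")
    case True
    then have ab: "a \<in> A" "b \<in> A" using EA by auto
    have n: "(\<sigma>' a, \<sigma>' b) \<notin> EA" "near EA 6 (\<sigma>' a) (\<sigma>' b)" using A' True by auto
    \<comment> \<open>An edge of \<open>ER\<close> with both ends in \<open>A\<close> could only be
      a loop at \<open>c\<close>.\<close>
    have "(\<sigma>' a, \<sigma>' b) \<notin> ER"
      using ER(1,3) tA[OF ab(1)] tA[OF ab(2)] disj by auto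
    then show ?thesis using n ab sA mA by auto
  next
    case False
    then have e: "(a, b) \<in> ER" "(b, a) \<in> ER" using that ER(2) by (auto dest: symD)
    show ?thesis
    proof (cases "a \<in> R \<and> b \<in> R")
      case True
      then have "(\<tau> a, \<tau> b) \<notin> EA" using tR EA disj by blast
      then show ?thesis using RE[OF e(1)] True sR mX by auto
    next
      case F: False
      then consider "a = c" "c \<notin> R" | "b = c" "c \<notin> R" using e ER by auto
      then show ?thesis
      proof cases
        case 2
        then have "(\<sigma> b, \<sigma> a) \<notin> ?E \<and> near ?E 6 (\<sigma> b) (\<sigma> a)" using cross e by auto
        then show ?thesis using near_sym[OF sE] sE by (meson symD)
      qed (use cross e in auto)
    qed
  qed
  have 4: "near ?E 2 x (\<sigma> x)" using x A' sA sR mA mX by (metis order_refl)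
  have 5: "near ?E 3 y (\<sigma> y)" if xy: "(x, y) \<in> ?E" for y
    using x
  proof
    assume h: "x \<in> A \<and> x' = x \<and> (\<forall>b. (c, b) \<in> ER \<longrightarrow> b \<in> R \<longrightarrow> x = c \<longrightarrow> near ER 3 b (\<tau> b))"
    show ?thesis
    proof (cases "(x, y) \<in> EA")
      case True
      then show ?thesis using EA A' h sA mA by (metis SigmaE2 order_refl subset_iff)
    next
      case False
      then have "x = c" "y \<in> R" using xy h ER disj by auto
      then show ?thesis using False xy h sR mX by auto
    qed
  next
    assume h: "x \<in> R \<and> near ER 2 x (\<tau> x) \<and> (\<forall>b\<in>R. (x, b) \<in> ER \<longrightarrow> near ER 3 b (\<tau> b)) \<and> (c \<notin> R \<longrightarrow> x' = c)"
    then have e: "(x, y) \<in> ER" using xy EA disj by auto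
    show ?thesis
    proof (cases "y \<in> R")
      case True
      then show ?thesis using e h sR mX by auto
    next
      case False
      then have "y = c" "c \<notin> R" using e ER by auto
      \<comment> \<open>Here the neighbour \<open>c\<close> of \<open>x\<close> is the distinguished
        vertex of the smaller placement, so it moves by at most 2, within the 3 allowed to a
        neighbour.\<close>
      then show ?thesis using h c A' sA mA[of 2 c _ 3] by auto
    qed
  qed
  have "placement (A \<union> R) ?E x \<sigma>" unfolding placement_def using 1 2 3 4 5 by auto
  then show ?thesis by blast
qed

section \<open>Small trees and removable parts\<close>

text \<open>Concrete trees are given by the list \<open>vs\<close> of their vertices and a list \<open>par\<close> of parent
  indices; the root has index 0 and is its own parent.\<close>

definition tree_edges :: "'a list \<Rightarrow> nat list \<Rightarrow> 'a rel" where
  "tree_edges vs par = (let S = set (zip (tl vs) (map ((!) vs) (tl par))) in S \<union> S\<inverse>)"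

text \<open>The guards \<open>0 < i\<close> and \<open>0 < j\<close> keep the root, which is its own
  parent, from carrying a loop.\<close>

definition adjacent :: "nat list \<Rightarrow> nat \<Rightarrow> nat \<Rightarrow> bool" where
  "adjacent par i j \<longleftrightarrow> 0 < i \<and> par ! i = j \<or> 0 < j \<and> par ! j = i"

text \<open>A condition for distance at most \<open>k\<close> that can be evaluated: climbing
  \<open>a\<close> steps from \<open>i\<close> and \<open>b\<close> steps from \<open>j\<close>,
  with \<open>a + b \<le> k\<close>, leads to the same ancestor.\<close>

definition close :: "nat list \<Rightarrow> nat \<Rightarrow> nat \<Rightarrow> nat \<Rightarrow> bool" where
  "close par k i j \<longleftrightarrow>
     list_ex (\<lambda>a. list_ex (\<lambda>b. ((!) par ^^ a) i = ((!) par ^^ b) j) [0..<Suc k - a]) [0..<Suc k]"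

definition wf_parents :: "nat list \<Rightarrow> bool" where
  "wf_parents par \<longleftrightarrow> par \<noteq> [] \<and> par ! 0 = 0 \<and> list_all (\<lambda>i. i < length par) par"

text \<open>The permutation \<open>p\<close> moves the vertices of index at least \<open>s\<close>, where \<open>s\<close> is 0 (whole tree)
  or 1 (everything but the root, whose image is then only known to be at distance at most \<open>6 - k\<close>).\<close>

definition moves :: "nat \<Rightarrow> nat \<Rightarrow> nat list \<Rightarrow> nat list \<Rightarrow> bool" where
  "moves s k par p \<longleftrightarrow> wf_parents par \<and> length p = length par \<and> distinct p \<and>
     list_all (\<lambda>i. s \<le> p ! i \<and> p ! i < length par \<and> p ! i \<noteq> i \<and> close par 4 i (p ! i)
       \<and> list_ex (\<lambda>j. ((!) p ^^ j) i = i) [1..<6]) [s..<length par] \<and>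
     list_all (\<lambda>i. if par ! i < s then close par k 0 (p ! i)
       else \<not> adjacent par (p ! i) (p ! (par ! i)) \<and> close par 6 (p ! i) (p ! (par ! i)))
       [1..<length par]"

definition moves_near :: "nat \<Rightarrow> nat list \<Rightarrow> nat list \<Rightarrow> nat \<Rightarrow> bool" where
  "moves_near s par p x \<longleftrightarrow>
     list_all (\<lambda>i. adjacent par x i \<longrightarrow> close par 3 i (p ! i)) [s..<length par]"

text \<open>A list of permutations is allowed because the choice may depend on the distinguished
  vertex \<open>x\<close>.\<close>

definition small_tree :: "nat list \<Rightarrow> nat list list \<Rightarrow> bool" where
  "small_tree par ps \<longleftrightarrow>
     list_all (\<lambda>x. list_ex (\<lambda>p. moves 0 0 par p \<and> moves_near 0 par p x \<and> close par 2 x (p ! x)) ps)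
       [0..<length par]"

text \<open>If the distinguished vertex remains in the smaller tree, the attachment vertex may move by 4
  there, which leaves \<open>k = 2\<close>. Otherwise the attachment vertex becomes the distinguished one and
  moves by at most 2, which leaves \<open>k = 4\<close>.\<close>

definition removable_out :: "nat list \<Rightarrow> nat list \<Rightarrow> bool" where
  "removable_out par p \<longleftrightarrow> moves 1 2 par p \<and> moves_near 1 par p 0"

definition removable_in :: "nat list \<Rightarrow> nat list list \<Rightarrow> bool" where
  "removable_in par ps \<longleftrightarrow>
     list_all (\<lambda>x. list_ex (\<lambda>p. moves 1 4 par p \<and> moves_near 1 par p x \<and> close par 2 x (p ! x)) ps)
       [1..<length par]"

text \<open>The permutations below were found by exhaustive search. For two legs with three vertices
  each there is no analogue for \<open>removable_in\<close>; the induction avoids this case by choosing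
  legs that do not contain the distinguished vertex.\<close>

lemma small_trees:
  "small_tree [0,0,1,2] [[1,3,0,2]]"
  "small_tree [0,0,0,2] [[1,2,3,0]]"
  "small_tree [0,0,0,2,3] [[1,2,4,0,3]]"
  "small_tree [0,0,1,0,3] [[2,3,1,4,0]]"
  "small_tree [0,0,1,0,3,4] [[2,0,4,5,1,3], [5,3,1,2,0,4]]"
  "small_tree [0,0,1,2,0,4,5] [[2,4,3,0,6,1,5], [3,5,0,2,1,6,4]]"
  "small_tree [0,0,0,0,3] [[1,2,3,4,0]]"
  "small_tree [0,0,0,2,0,4] [[1,3,5,0,2,4], [3,0,4,1,5,2]]"
  "small_tree [0,0,1,0,3,0,5] [[1,3,5,4,0,6,2], [1,4,0,6,2,3,5]]"
  "small_tree [0,0,0,0,1,1] [[2,4,1,5,0,3], [2,4,5,1,3,0]]"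
  by code_simp+

text \<open>The index lists describe two legs at the root with 1 and 1, 1 and 2, 1 and 3, 2 and 2, 2
  and 3, 3 and 3 vertices; the last one is a single pendant path with four vertices.\<close>

lemma removables:
  "removable_out [0,0,0] [0,2,1]"
  "removable_in [0,0,0] [[0,2,1]]"
  "removable_out [0,0,0,2] [0,2,3,1]"
  "removable_in [0,0,0,2] [[0,2,3,1], [0,3,1,2]]"
  "removable_out [0,0,0,2,3] [0,3,1,4,2]"
  "removable_in [0,0,0,2,3] [[0,2,4,1,3], [0,3,1,4,2]]"
  "removable_out [0,0,1,0,3] [0,2,3,4,1]"
  "removable_in [0,0,1,0,3] [[0,2,3,4,1], [0,4,1,2,3]]"
  "removable_out [0,0,1,0,3,4] [0,2,4,1,5,3]"
  "removable_in [0,0,1,0,3,4] [[0,2,3,5,1,4], [0,4,1,2,5,3]]"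
  "removable_out [0,0,1,2,0,4,5] [0,5,3,4,2,6,1]"
  "removable_out [0,0,1,2,3] [0,2,4,1,3]"
  by code_simp+

section \<open>From index lists to graphs\<close>

lemma tree_edges_iff:
  assumes "distinct vs" "length vs = length par" "wf_parents par" "i < length par" "j < length par"
  shows "(vs ! i, vs ! j) \<in> tree_edges vs par \<longleftrightarrow> adjacent par i j"
proof -
  let ?S = "set (zip (tl vs) (map ((!) vs) (tl par)))"
  have *: "(vs ! i, vs ! j) \<in> ?S \<longleftrightarrow> 0 < i \<and> par ! i = j"
    if i: "i < length par" and j: "j < length par" for i j
  proof
    assume "(vs ! i, vs ! j) \<in> ?S"
    then obtain m where m: "m < length par - 1" "vs ! i = vs ! Suc m" "vs ! j = vs ! (par ! Suc m)"
      using assms(2) by (auto simp: set_zip nth_tl)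
    have "par ! Suc m < length par" using assms(3) m(1) by (auto simp: wf_parents_def list_all_length)
    then have "i = Suc m" "j = par ! Suc m"
      using m i j assms(1,2) by (auto simp: nth_eq_iff_index_eq)
    then show "0 < i \<and> par ! i = j" by simp
  next
    assume h: "0 < i \<and> par ! i = j"
    then have "i - 1 < length par - 1" "vs ! i = tl vs ! (i - 1)" "vs ! j = map ((!) vs) (tl par) ! (i - 1)"
      using i assms(2) by (auto simp: nth_tl)
    then show "(vs ! i, vs ! j) \<in> ?S"
      using assms(2) unfolding set_zip by fastforce
  qed
  show ?thesis using *[OF assms(4,5)] *[OF assms(5,4)]
    unfolding tree_edges_def adjacent_def Let_def by auto
qed

lemma sym_tree_edges: "sym (tree_edges vs par)"
  by (auto simp: tree_edges_def sym_def Let_def)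

lemma tree_edges_indices:
  assumes "length vs = length par" "wf_parents par" "(u, v) \<in> tree_edges vs par"
  obtains i j where "i < length par" "j < length par" "u = vs ! i" "v = vs ! j"
proof -
  have *: "\<exists>i j. i < length par \<and> j < length par \<and> u = vs ! i \<and> v = vs ! j"
    if e: "(u, v) \<in> set (zip (tl vs) (map ((!) vs) (tl par)))" for u v
  proof -
    obtain m where m: "m < length par - 1" "u = vs ! Suc m" "v = vs ! (par ! Suc m)"
      using e assms(1) unfolding in_set_zip by (auto simp: nth_tl)
    moreover have "par ! Suc m < length par" using assms(2) m(1) by (auto simp: wf_parents_def list_all_length)
    ultimately show ?thesis by (metis Suc_leI less_diff_conv Suc_eq_plus1)
  qed
  show thesis using assms(3) *[of u v] *[of v u] that unfolding tree_edges_def Let_def by auto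
qed

text \<open>Both climbs are walks to a common ancestor, and the second is reversed by symmetry. A
  climbing step at the root stays there and costs nothing.\<close>

lemma near_of_close:
  assumes "distinct vs" "length vs = length par" "wf_parents par" "i < length par" "j < length par"
    "close par k i j"
  shows "near (tree_edges vs par) k (vs ! i) (vs ! j)"
proof -
  let ?E = "tree_edges vs par"
  have up: "((!) par ^^ a) i < length par \<and> near ?E a (vs ! i) (vs ! (((!) par ^^ a) i))"
    if "i < length par" for a i
  proof (induction a)
    case (Suc a)
    let ?m = "((!) par ^^ a) i"
    have lt: "par ! ?m < length par" using Suc assms(3) by (auto simp: wf_parents_def list_all_length)
    have "near ?E 1 (vs ! ?m) (vs ! (par ! ?m))"
    proof (cases "?m = 0")
      case True
      then show ?thesis using assms(3) by (auto simp: wf_parents_def)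
    next
      case False
      then have "adjacent par ?m (par ! ?m)" by (simp add: adjacent_def)
      then have "(vs ! ?m, vs ! (par ! ?m)) \<in> ?E"
        using tree_edges_iff[OF assms(1,2,3)] Suc lt by blast
      then show ?thesis using near_edge by simp
    qed
    then show ?case using near_trans[of ?E a _ _ 1] Suc lt by auto
  qed (use that in auto)
  obtain a b where ab: "a \<le> k" "b \<le> k - a" "((!) par ^^ a) i = ((!) par ^^ b) j"
    using assms(6) unfolding close_def list_ex_iff by (auto simp: less_Suc_eq_le Suc_diff_le simp del: upt_Suc)
  let ?m = "vs ! (((!) par ^^ a) i)"
  have "near ?E b ?m (vs ! j)"
    unfolding ab(3) by (rule near_sym[OF sym_tree_edges conjunct2[OF up[OF assms(5)]]])
  then have "near ?E (a + b) (vs ! i) (vs ! j)"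
    by (rule near_trans[OF conjunct2[OF up[OF assms(4)]]])
  then show ?thesis by (rule near_mono) (use ab in auto)
qed

text \<open>The checks evaluated on indices supply the hypotheses of
  \<open>placement_extend\<close>. With \<open>s = 0\<close> the root belongs to the moved part;
  with \<open>s = 1\<close> it is the attachment vertex and lies in \<open>A\<close>.\<close>

lemma placement_extend_tree_edges:
  assumes vs: "distinct vs" "length vs = length par" and c: "vs ! 0 = c" and s: "s \<le> 1"
    and p: "moves s k par p"
    and EA: "EA \<subseteq> A \<times> A" "sym EA" and disj: "A \<inter> set (drop s vs) = {}" and A: "placement A EA x' \<sigma>'"
    and cA: "s = 1 \<Longrightarrow> c \<in> A \<and> near EA l c (\<sigma>' c)" and kl: "k + l \<le> 6"
    and x: "x \<in> A \<and> x' = x \<and> (x = c \<longrightarrow> moves_near s par p 0)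
      \<or> (\<exists>m. s \<le> m \<and> m < length par \<and> x = vs ! m \<and> close par 2 m (p ! m) \<and> moves_near s par p m)
        \<and> (s = 1 \<longrightarrow> x' = c)"
  shows "\<exists>\<sigma>. placement (A \<union> set (drop s vs)) (EA \<union> tree_edges vs par) x \<sigma>"
proof -
  let ?n = "length par" and ?E = "tree_edges vs par" and ?R = "set (drop s vs)"
  have wf: "wf_parents par" and lp: "length p = ?n" and dp: "distinct p"
    and p1: "\<And>i. s \<le> i \<Longrightarrow> i < ?n \<Longrightarrow> s \<le> p ! i \<and> p ! i < ?n \<and> p ! i \<noteq> i \<and> close par 4 i (p ! i)
       \<and> (\<exists>j\<in>{1..<6}. ((!) p ^^ j) i = i)"
    and p2: "\<And>i. 0 < i \<Longrightarrow> i < ?n \<Longrightarrow> if par ! i < s then close par k 0 (p ! i)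
       else \<not> adjacent par (p ! i) (p ! (par ! i)) \<and> close par 6 (p ! i) (p ! (par ! i))"
    using p unfolding moves_def list_all_iff list_ex_iff by (auto simp: Suc_le_eq)
  have n0: "0 < ?n" using wf by (auto simp: wf_parents_def)
  have par_lt: "par ! i < ?n" if "i < ?n" for i using wf that by (auto simp: wf_parents_def list_all_length)
  have Ri: "v \<in> ?R \<longleftrightarrow> (\<exists>i. s \<le> i \<and> i < ?n \<and> v = vs ! i)" for v
  proof
    assume "v \<in> ?R"
    then obtain i where "i < length (drop s vs)" "v = drop s vs ! i" by (auto simp: in_set_conv_nth)
    then show "\<exists>i. s \<le> i \<and> i < ?n \<and> v = vs ! i"
      using vs(2) n0 s by (intro exI[of _ "s + i"]) auto
  next
    assume "\<exists>i. s \<le> i \<and> i < ?n \<and> v = vs ! i"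
    then obtain i where "s \<le> i" "i < ?n" "v = vs ! i" by blast
    then have "v = drop s vs ! (i - s)" "i - s < length (drop s vs)" using vs(2) by auto
    then show "v \<in> ?R" by (metis nth_mem)
  qed
  have Rob: "\<exists>i. s \<le> i \<and> i < ?n \<and> v = vs ! i" if "v \<in> ?R" for v
    using Ri that by simp
  have inj: "vs ! i = vs ! j \<longleftrightarrow> i = j" if "i < ?n" "j < ?n" for i j
    using vs that by (simp add: nth_eq_iff_index_eq)
  define \<tau> where "\<tau> v = the (map_of (zip vs (map ((!) vs) p)) v)" for v
  have \<tau>: "\<tau> (vs ! i) = vs ! (p ! i)" if "i < ?n" for i
    unfolding \<tau>_def using map_of_zip_nth[OF _ vs(1), of "map ((!) vs) p" i] that vs(2) lp by simp
  note nr = near_of_close[OF vs wf] and te = tree_edges_iff[OF vs wf]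
  have \<tau>R: "\<tau> ` ?R \<subseteq> ?R"
  proof
    fix v assume "v \<in> \<tau> ` ?R"
    then obtain i where "s \<le> i" "i < ?n" "v = \<tau> (vs ! i)" using Ri by auto
    then show "v \<in> ?R" using Ri \<tau> p1 by metis
  qed
  have "inj_on \<tau> ?R"
  proof (rule inj_onI)
    fix u v assume "u \<in> ?R" "v \<in> ?R" "\<tau> u = \<tau> v"
    then obtain i j where ij: "s \<le> i" "i < ?n" "u = vs ! i" "s \<le> j" "j < ?n" "v = vs ! j"
      using Rob[of u] Rob[of v] by blast
    then have "p ! i = p ! j" using \<open>\<tau> u = \<tau> v\<close> \<tau> inj p1 by metis
    then show "u = v" using ij dp lp by (simp add: nth_eq_iff_index_eq)
  qed
  then have bij: "bij_betw \<tau> ?R ?R"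
    using endo_inj_surj[OF _ \<tau>R] by (simp add: bij_betw_def)
  have cyc: "s \<le> ((!) p ^^ j) i \<and> ((!) p ^^ j) i < ?n \<and> (\<tau> ^^ j) (vs ! i) = vs ! (((!) p ^^ j) i)"
    if "s \<le> i" "i < ?n" for i j
    by (induction j) (use that p1 \<tau> in auto)
  have mv: "\<tau> y \<noteq> y \<and> near ?E 4 y (\<tau> y) \<and> short_cycle \<tau> y" if yR: "y \<in> ?R" for y
  proof -
    obtain i where i: "s \<le> i" "i < ?n" "y = vs ! i" using Rob[OF yR] by blast
    obtain j where j: "j \<in> {1..<6}" "((!) p ^^ j) i = i" using p1[OF i(1,2)] by blast
    then have "(\<tau> ^^ j) y = y" "j \<in> {1..5}" using cyc[OF i(1,2), of j] i by auto
    then have "short_cycle \<tau> y" unfolding short_cycle_def by blast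
    then show ?thesis using i p1[OF i(1,2)] \<tau>[OF i(2)] inj nr by auto
  qed
  have ed: "(\<tau> a, \<tau> b) \<notin> ?E \<and> near ?E 6 (\<tau> a) (\<tau> b)" if ab: "(a, b) \<in> ?E" "a \<in> ?R" "b \<in> ?R" for a b
  proof -
    obtain i j where ij: "s \<le> i" "i < ?n" "a = vs ! i" "s \<le> j" "j < ?n" "b = vs ! j"
      using Rob[OF ab(2)] Rob[OF ab(3)] by blast
    \<comment> \<open>\<open>p2\<close> checks each edge once, from child to parent; the other
      direction follows by symmetry.\<close>
    have *: "\<not> adjacent par (p ! i) (p ! j) \<and> close par 6 (p ! i) (p ! j)"
      if "0 < i" "par ! i = j" "i < ?n" "s \<le> j" for i j
      using p2[of i] that by auto
    have "adjacent par i j" using ab(1) te ij by blast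
    then consider "0 < i" "par ! i = j" | "0 < j" "par ! j = i" unfolding adjacent_def by meson
    then show ?thesis
    proof cases
      case 1
      then show ?thesis using * ij \<tau> te nr p1 by auto
    next
      case 2
      then have "(\<tau> b, \<tau> a) \<notin> ?E \<and> near ?E 6 (\<tau> b) (\<tau> a)" using * ij \<tau> te nr p1 by auto
      then show ?thesis using sym_tree_edges near_sym by (metis symD)
    qed
  qed
  have cR: "c \<notin> ?R \<Longrightarrow> s = 1" using Ri[of c] c n0 s by (cases "s = 1") auto
  have root: "near ?E k c (\<tau> b) \<and> near EA l c (\<sigma>' c)" if "c \<notin> ?R" and e: "(c, b) \<in> ?E" for b
  proof -
    have s1: "s = 1" using cR that by blast
    obtain j where j: "j < ?n" "b = vs ! j" using tree_edges_indices[OF vs(2) wf e] by metis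
    then have "adjacent par 0 j" using e te[of 0 j] c n0 by auto
    \<comment> \<open>Index 0 has no edge to a parent, so every neighbour of the root is one of its
      children.\<close>
    then have "0 < j" "par ! j = 0" unfolding adjacent_def by auto
    then have "close par k 0 (p ! j)" using p2[of j] j s1 by auto
    then have "near ?E k c (\<tau> b)" using nr[of 0 "p ! j" k] c n0 \<tau> j p1[of j] s1 \<open>0 < j\<close> by auto
    then show ?thesis using cA s1 by blast
  qed
  have mn: "near ?E 3 b (\<tau> b)" if "moves_near s par p m" "m < ?n" and bR: "b \<in> ?R" and "(vs ! m, b) \<in> ?E" for m b
  proof -
    obtain j where j: "s \<le> j" "j < ?n" "b = vs ! j" using Rob[OF bR] by blast
    then have "adjacent par m j" using that te by auto
    then have "close par 3 j (p ! j)" using that j unfolding moves_near_def list_all_iff by auto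
    then show ?thesis using nr \<tau> j p1 by auto
  qed
  have sub: "?E \<subseteq> insert c ?R \<times> insert c ?R"
  proof -
    have "vs ! i \<in> insert c ?R" if "i < ?n" for i
    proof (cases "i = 0")
      case False
      then have "s \<le> i" using s by simp
      then show ?thesis using Ri that by blast
    qed (use c in auto)
    then show ?thesis using tree_edges_indices[OF vs(2) wf] by (metis mem_Sigma_iff subrelI)
  qed
  have cc: "(c, c) \<notin> ?E" using te[of 0 0] c n0 by (auto simp: adjacent_def)
  have x': "x \<in> A \<and> x' = x \<and> (\<forall>b. (c, b) \<in> ?E \<longrightarrow> b \<in> ?R \<longrightarrow> x = c \<longrightarrow> near ?E 3 b (\<tau> b))
    \<or> x \<in> ?R \<and> near ?E 2 x (\<tau> x) \<and> (\<forall>b\<in>?R. (x, b) \<in> ?E \<longrightarrow> near ?E 3 b (\<tau> b)) \<and> (c \<notin> ?R \<longrightarrow> x' = c)"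
    using x
  proof
    assume "x \<in> A \<and> x' = x \<and> (x = c \<longrightarrow> moves_near s par p 0)"
    then show ?thesis using mn[of 0] c n0 by blast
  next
    assume h: "(\<exists>m. s \<le> m \<and> m < length par \<and> x = vs ! m \<and> close par 2 m (p ! m) \<and> moves_near s par p m)
        \<and> (s = 1 \<longrightarrow> x' = c)"
    then obtain m where m: "s \<le> m" "m < ?n" "x = vs ! m" "close par 2 m (p ! m)" "moves_near s par p m"
      by blast
    have "near ?E 2 x (\<tau> x)" using m nr \<tau> p1 by auto
    moreover have "x \<in> ?R" using m Ri[of x] by blast
    ultimately show ?thesis using h cR mn m by blast
  qed
  show ?thesis
    by (rule placement_extend[OF EA(1) sub sym_tree_edges cc disj A bij mv ed _ root kl x' EA(2)])
      (use cR cA in auto)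
qed

lemma placement_small_tree:
  assumes "distinct vs" "length vs = length par" "small_tree par ps" "x \<in> set vs"
  shows "\<exists>\<sigma>. placement (set vs) (tree_edges vs par) x \<sigma>"
proof -
  obtain m where m: "m < length par" "x = vs ! m" using assms(2,4) by (auto simp: in_set_conv_nth)
  then obtain p where "moves 0 0 par p" "moves_near 0 par p m" "close par 2 m (p ! m)"
    using assms(3) unfolding small_tree_def list_all_iff list_ex_iff by (metis atLeastLessThan_iff set_upt zero_le)
  \<comment> \<open>The empty graph is placed trivially, so the whole placement comes from
    \<open>p\<close>.\<close>
  moreover have "placement {} {} x id" by (simp add: placement_def)
  ultimately show ?thesis
    using placement_extend_tree_edges[OF assms(1,2) refl, of 0 0 p "{}" "{}" x id 0 x] m
    by (auto simp: sym_def)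
qed

lemma placement_removable_out:
  assumes "distinct (c # ws)" "length (c # ws) = length par" "removable_out par p"
    "EA \<subseteq> A \<times> A" "sym EA" "A \<inter> set ws = {}" "c \<in> A" "x \<in> A"
    "\<exists>\<sigma>. placement A EA x \<sigma>"
  shows "\<exists>\<sigma>. placement (A \<union> set ws) (EA \<union> tree_edges (c # ws) par) x \<sigma>"
proof -
  obtain \<sigma> where \<sigma>: "placement A EA x \<sigma>" using assms(9) by blast
  \<comment> \<open>Here the bound 4 is used for a vertex \<open>c\<close> that need not be a
    leaf.\<close>
  then have "near EA 4 c (\<sigma> c)" using assms(7) by (auto simp: placement_def)
  then show ?thesis
    using placement_extend_tree_edges[OF assms(1,2) refl, of 1 2 p EA A x \<sigma> 4 x] \<sigma> assms(3-8)
    by (auto simp: removable_out_def)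
qed

lemma placement_removable_in:
  assumes "distinct (c # ws)" "length (c # ws) = length par" "removable_in par ps"
    "EA \<subseteq> A \<times> A" "sym EA" "A \<inter> set ws = {}" "c \<in> A" "x \<in> set ws"
    "\<exists>\<sigma>. placement A EA c \<sigma>"
  shows "\<exists>\<sigma>. placement (A \<union> set ws) (EA \<union> tree_edges (c # ws) par) x \<sigma>"
proof -
  obtain \<sigma> where \<sigma>: "placement A EA c \<sigma>" using assms(9) by blast
  then have n: "near EA 2 c (\<sigma> c)" by (auto simp: placement_def)
  obtain i where i: "i < length ws" "x = ws ! i" using assms(8) by (auto simp: in_set_conv_nth)
  then have m: "Suc i < length par" "x = (c # ws) ! Suc i" using assms(2) by auto
  then obtain p where p: "moves 1 4 par p" "moves_near 1 par p (Suc i)" "close par 2 (Suc i) (p ! Suc i)"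
    using assms(3) unfolding removable_in_def list_all_iff list_ex_iff by fastforce
  have "\<exists>\<sigma>. placement (A \<union> set (drop 1 (c # ws))) (EA \<union> tree_edges (c # ws) par) x \<sigma>"
  proof (rule placement_extend_tree_edges[OF assms(1,2) _ _ p(1) assms(4,5) _ \<sigma>, where l = 2])
    show "x \<in> A \<and> c = x \<and> (x = c \<longrightarrow> moves_near 1 par p 0) \<or>
      (\<exists>m. 1 \<le> m \<and> m < length par \<and> x = (c # ws) ! m \<and> close par 2 m (p ! m)
        \<and> moves_near 1 par p m) \<and> (1 = 1 \<longrightarrow> c = c)"
      using m p by (intro disjI2 conjI exI[of _ "Suc i"]) auto
  qed (use assms(6,7) n in auto)
  then show ?thesis by simp
qed

section \<open>Trees\<close>

definition link :: "'a rel \<Rightarrow> 'a rel \<Rightarrow> 'a \<Rightarrow> 'a \<Rightarrow> 'a rel" where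
  "link E F a b = E \<union> F \<union> {(a, b), (b, a)}"

lemma link_commute: "link E F a b = link F E b a"
  by (auto simp: link_def)

text \<open>Growing trees by leaves gives an induction rule in place of arguments about
  connectedness and cycles. That every tree in the sense of \<open>is_tree\<close> arises this way
  is \<open>tree_of_is_tree\<close>.\<close>

inductive tree :: "'a set \<Rightarrow> 'a rel \<Rightarrow> bool" where
  single: "tree {v} {}"
| leaf: "tree V E \<Longrightarrow> u \<in> V \<Longrightarrow> w \<notin> V \<Longrightarrow> tree (insert w V) (E \<union> {(u, w), (w, u)})"

lemma tree_finite: "tree V E \<Longrightarrow> finite V"
  by (induction rule: tree.induct) auto

lemma tree_nonempty: "tree V E \<Longrightarrow> V \<noteq> {}"
  by (induction rule: tree.induct) auto

lemma tree_edges_subset: "tree V E \<Longrightarrow> E \<subseteq> V \<times> V"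
  by (induction rule: tree.induct) auto

lemma tree_sym: "tree V E \<Longrightarrow> sym E"
  by (induction rule: tree.induct) (auto simp: sym_def)

lemma tree_irrefl: "tree V E \<Longrightarrow> (v, v) \<notin> E"
  by (induction rule: tree.induct) auto

lemma tree_neighbour: "tree V E \<Longrightarrow> v \<in> V \<Longrightarrow> V \<noteq> {v} \<Longrightarrow> \<exists>w. (v, w) \<in> E"
proof (induction arbitrary: v rule: tree.induct)
  case (leaf V E u w)
  show ?case
  proof (cases "v = w \<or> v = u")
    case False
    then have "v \<in> V" "V \<noteq> {v}" using leaf by auto
    then show ?thesis using leaf.IH by blast
  qed auto
qed auto

lemma tree_singleton: "tree {v} E \<Longrightarrow> E = {}"
  using tree_edges_subset[of "{v}" E] tree_irrefl[of "{v}" E] by auto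

lemma tree_link:
  assumes "tree B F" "tree A E" "A \<inter> B = {}" "a \<in> A" "b \<in> B"
  shows "tree (A \<union> B) (link E F a b)"
  using assms
proof (induction arbitrary: A E a b rule: tree.induct)
  case (single v)
  then show ?case using tree.leaf[of A E a b] by (simp add: link_def)
next
  case (leaf V F u w)
  show ?case
  proof (cases "b = w")
    case True
    \<comment> \<open>If the last leaf \<open>w\<close> of the second tree is the end
      \<open>b\<close> of the joining edge, it is first attached to \<open>A\<close> as a leaf at
      \<open>a\<close>; then \<open>wu\<close> serves as the joining edge. This is why the first
      tree and both end vertices are arbitrary in the induction.\<close>
    have "tree (insert w A) (E \<union> {(a, w), (w, a)})"
      using tree.leaf[of A E a w] leaf by blast
    then have "tree (insert w A \<union> V) (link (E \<union> {(a, w), (w, a)}) F w u)"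
      using leaf by (intro leaf.IH) auto
    moreover have "link (E \<union> {(a, w), (w, a)}) F w u = link E (F \<union> {(u, w), (w, u)}) a b"
      using True by (auto simp: link_def)
    ultimately show ?thesis by simp
  next
    case False
    then have "tree (A \<union> V) (link E F a b)" using leaf by (intro leaf.IH) auto
    then have "tree (insert w (A \<union> V)) (link E F a b \<union> {(u, w), (w, u)})"
      using leaf by (intro tree.leaf) auto
    moreover have "link E F a b \<union> {(u, w), (w, u)} = link E (F \<union> {(u, w), (w, u)}) a b"
      by (auto simp: link_def)
    ultimately show ?thesis by simp
  qed
qed

definition split :: "'a set \<Rightarrow> 'a rel \<Rightarrow> 'a \<Rightarrow> 'a \<Rightarrow> 'a set \<Rightarrow> 'a rel \<Rightarrow> 'a set \<Rightarrow> 'a rel \<Rightarrow> bool" where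
  "split V E a b A EA B EB \<longleftrightarrow> tree A EA \<and> tree B EB \<and> a \<in> A \<and> b \<in> B \<and> A \<inter> B = {}
     \<and> V = A \<union> B \<and> E = link EA EB a b"

lemma split_commute: "split V E a b A EA B EB \<Longrightarrow> split V E b a B EB A EA"
  unfolding split_def using link_commute[of EA EB a b] by (simp add: Int_commute Un_commute)

text \<open>The leaf added last either joins the side that contains its neighbour or, when its own
  edge is cut, forms a side by itself. By \<open>split_commute\<close> it suffices to let the first
  side grow.\<close>

lemma tree_split:
  "tree V E \<Longrightarrow> (a, b) \<in> E \<Longrightarrow> \<exists>A EA B EB. split V E a b A EA B EB"
proof (induction arbitrary: a b rule: tree.induct)
  case (leaf V E u w)
  have grow: "\<exists>A EA B EB. split (insert w V) (E \<union> {(u, w), (w, u)}) a b A EA B EB"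
    if "split V E a b A EA B EB" "u \<in> A" for a b A EA B EB
  proof -
    have "tree (insert w A) (EA \<union> {(u, w), (w, u)})"
      using that leaf(3) by (intro tree.leaf) (auto simp: split_def)
    then have "split (insert w V) (E \<union> {(u, w), (w, u)}) a b (insert w A) (EA \<union> {(u, w), (w, u)}) B EB"
      using that leaf(3) unfolding split_def link_def by auto
    then show ?thesis by blast
  qed
  have new: "split (insert w V) (E \<union> {(u, w), (w, u)}) u w V E {w} {}"
    using leaf(1-3) tree.single[of w] by (auto simp: split_def link_def)
  show ?case
  proof (cases "(a, b) \<in> E")
    case True
    then obtain A EA B EB where s: "split V E a b A EA B EB" using leaf.IH by blast
    show ?thesis
    proof (cases "u \<in> A")
      case True
      then show ?thesis using grow[OF s] by blast
    next
      case False
      then have "u \<in> B" using leaf(2) s by (auto simp: split_def)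
      then obtain A' EA' B' EB'
        where "split (insert w V) (E \<union> {(u, w), (w, u)}) b a A' EA' B' EB'"
        using grow[OF split_commute[OF s]] by blast
      from split_commute[OF this] show ?thesis by blast
    qed
  next
    case False
    then consider "a = u" "b = w" | "a = w" "b = u" using leaf.prems by auto
    then show ?thesis
    proof cases
      case 1
      then show ?thesis using new by blast
    next
      case 2
      then show ?thesis using split_commute[OF new] by blast
    qed
  qed
qed simp

text \<open>A branch of \<open>B\<close> at \<open>b\<close> is also a branch of the whole tree.
  Hence what is known about sides of edges of the whole tree applies to it.\<close>

lemma split_split:
  assumes "split V E a b A EA B EB" "split B EB b w B' EB' W EW"
  shows "split V E b w (A \<union> B') (link EA EB' a b) W EW"
proof -
  have "tree (A \<union> B') (link EA EB' a b)"
    using assms unfolding split_def by (intro tree_link) auto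
  then show ?thesis using assms unfolding split_def link_def by auto
qed

text \<open>Cutting the edge \<open>va\<close> isolates \<open>a\<close>: any further neighbour of
  \<open>a\<close> on its side would have to be \<open>v\<close>, which lies on the other
  side.\<close>

lemma tree_remove_leaf:
  assumes "tree V E" "a \<in> V" "{u. (a, u) \<in> E} = {v}"
  shows "tree (V - {a}) (E - {(v, a), (a, v)})"
proof -
  have va: "(v, a) \<in> E" using assms tree_sym by (metis mem_Collect_eq singletonI symD)
  then obtain A EA B EB where s: "split V E v a A EA B EB" using tree_split assms(1) by metis
  have "B = {a}"
  proof (rule ccontr)
    assume "B \<noteq> {a}"
    then obtain u where u: "(a, u) \<in> EB" using s tree_neighbour[of B EB a] unfolding split_def by blast
    then have "u \<in> B" using s tree_edges_subset[of B EB] unfolding split_def by blast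
    moreover have "u = v" using assms(3) u s unfolding split_def link_def by blast
    ultimately show False using s unfolding split_def by blast
  qed
  then have "EB = {}" using s tree_singleton unfolding split_def by metis
  moreover have "(v, a) \<notin> EA" "(a, v) \<notin> EA"
    using s tree_edges_subset[of A EA] unfolding split_def by auto
  ultimately have "V - {a} = A" "E - {(v, a), (a, v)} = EA"
    using s \<open>B = {a}\<close> unfolding split_def link_def by auto
  then show ?thesis using s unfolding split_def by simp
qed

section \<open>Paths, and trees in the sense of \<open>is_tree\<close>\<close>

definition is_path :: "'a rel \<Rightarrow> 'a list \<Rightarrow> bool" where
  "is_path E xs \<longleftrightarrow> distinct xs \<and> (\<forall>i < length xs - 1. (xs ! i, xs ! Suc i) \<in> E)"

lemma is_path_Cons:
  assumes "is_path E xs" "xs \<noteq> []" "(w, hd xs) \<in> E" "w \<notin> set xs"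
  shows "is_path E (w # xs)"
  using assms unfolding is_path_def
  by (auto simp: nth_Cons hd_conv_nth Suc_less_eq2 split: nat.split)

lemma is_path_rev: "is_path E xs \<Longrightarrow> sym E \<Longrightarrow> is_path E (rev xs)"
  unfolding is_path_def
proof (intro conjI allI impI)
  fix i
  assume *: "distinct xs \<and> (\<forall>i<length xs - 1. (xs ! i, xs ! Suc i) \<in> E)" "sym E" "i < length (rev xs) - 1"
  let ?j = "length xs - Suc (Suc i)"
  have "?j < length xs - 1" "Suc ?j = length xs - Suc i" using *(3) by auto
  then have "(xs ! ?j, xs ! (length xs - Suc i)) \<in> E" using *(1) by metis
  then show "(rev xs ! i, rev xs ! Suc i) \<in> E" using * by (simp add: rev_nth symD)
qed simp

lemma tree_path:
  "tree V E \<Longrightarrow> u \<in> V \<Longrightarrow> v \<in> V \<Longrightarrow>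
    \<exists>xs. is_path E xs \<and> set xs \<subseteq> V \<and> xs \<noteq> [] \<and> hd xs = u \<and> last xs = v"
proof (induction arbitrary: u v rule: tree.induct)
  case (single w)
  then show ?case by (intro exI[of _ "[w]"]) (simp add: is_path_def)
next
  case (leaf V E t w)
  let ?E = "E \<union> {(t, w), (w, t)}"
  have sym: "sym ?E" using leaf(1) tree_sym by (auto simp: sym_def)
  have mono: "is_path E xs \<Longrightarrow> is_path ?E xs" for xs by (auto simp: is_path_def)
  have new: "\<exists>xs. is_path ?E xs \<and> set xs \<subseteq> insert w V \<and> xs \<noteq> [] \<and> hd xs = w \<and> last xs = v"
    if "v \<in> V" for v
  proof -
    obtain xs where xs: "is_path E xs" "set xs \<subseteq> V" "xs \<noteq> []" "hd xs = t" "last xs = v"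
      using leaf.IH[OF leaf(2) \<open>v \<in> V\<close>] by blast
    then have "is_path ?E (w # xs)" using leaf(3) by (intro is_path_Cons mono) auto
    then show ?thesis using xs by (intro exI[of _ "w # xs"]) auto
  qed
  consider "u \<in> V" "v \<in> V" | "u = w" "v = w" | "u = w" "v \<in> V" | "u \<in> V" "v = w"
    using leaf.prems by blast
  then show ?case
  proof cases
    case 1
    then show ?thesis using leaf.IH[OF 1] mono by blast
  next
    case 2
    then show ?thesis by (intro exI[of _ "[w]"]) (simp add: is_path_def)
  next
    case 3
    then show ?thesis using new by blast
  next
    case 4
    obtain xs where xs: "is_path ?E xs" "set xs \<subseteq> insert w V" "xs \<noteq> []" "hd xs = w" "last xs = u"
      using new[OF 4(1)] by blast
    then show ?thesis using 4 is_path_rev[OF xs(1) sym]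
      by (intro exI[of _ "rev xs"]) (auto simp: hd_rev last_rev)
  qed
qed

text \<open>A maximal subset inducing a \<open>tree\<close> is everything: a vertex adjacent to it has only one
  neighbour in it, since two neighbours would close a cycle.\<close>

lemma tree_of_is_tree:
  assumes "is_tree V E" shows "tree V E"
proof -
  have fin: "finite V" and EV: "E \<subseteq> V \<times> V" and symE: "sym E" and irr: "irrefl E" and ne: "V \<noteq> {}"
    and conn: "\<And>u v. u \<in> V \<Longrightarrow> v \<in> V \<Longrightarrow> (u, v) \<in> E\<^sup>*" and acyc: "\<And>cs. \<not> is_cycle E cs"
    using assms unfolding is_tree_def simple_graph_def connected_graph_def by auto
  let ?Q = "\<lambda>S. S \<subseteq> V \<and> tree S (E \<inter> S \<times> S)"
  obtain v0 where v0: "v0 \<in> V" using ne by blast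
  have "E \<inter> {v0} \<times> {v0} = {}" using irr by (auto simp: irrefl_def)
  then have "?Q {v0}" using v0 tree.single[of v0] by simp
  moreover have "\<forall>T. ?Q T \<longrightarrow> card T < Suc (card V)"
    using card_mono[OF fin] by (simp add: le_imp_less_Suc)
  ultimately have "\<exists>S. ?Q S \<and> (\<forall>T. ?Q T \<longrightarrow> card T \<le> card S)"
    by (rule ex_has_greatest_nat[of ?Q])
  then obtain S where S: "?Q S" and max: "\<And>T. ?Q T \<Longrightarrow> card T \<le> card S"
    by auto
  have "S = V"
  proof (rule ccontr)
    assume "S \<noteq> V"
    then obtain z where z: "z \<in> V" "z \<notin> S" using S by blast
    obtain r where r: "r \<in> S" using S tree_nonempty by blast
    have "(r, z) \<in> E\<^sup>*" using conn r z S by blast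
    \<comment> \<open>A walk from \<open>S\<close> to a vertex outside crosses the boundary of
      \<open>S\<close> along some edge \<open>uw\<close>.\<close>
    then obtain u w where uw: "(u, w) \<in> E" "u \<in> S" "w \<notin> S"
      using z(2) r by (induction rule: rtrancl_induct) blast+
    have wV: "w \<in> V" using uw EV by blast
    have only: "u' = u" if "(u', w) \<in> E" "u' \<in> S" for u'
    proof (rule ccontr)
      assume "u' \<noteq> u"
      obtain xs where xs: "is_path (E \<inter> S \<times> S) xs" "set xs \<subseteq> S" "xs \<noteq> []" "hd xs = u" "last xs = u'"
        using tree_path[of S _ u u'] S uw(2) \<open>u' \<in> S\<close> by blast
      have "(w, u) \<in> E" using uw symE by (meson symD)
      then have p: "is_path E (w # xs)"
        using xs uw(3) by (intro is_path_Cons) (auto simp: is_path_def)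
      \<comment> \<open>The path has two distinct ends, so with \<open>w\<close> it has the three
        vertices that a cycle needs.\<close>
      have "length xs \<ge> 2"
        using xs(3-5) \<open>u' \<noteq> u\<close> by (cases xs; cases "tl xs") auto
      then have "is_cycle E (w # xs)"
        using p xs(3,5) \<open>(u', w) \<in> E\<close> unfolding is_cycle_def is_path_def
        by (metis Suc_le_mono last_ConsR length_Cons list.sel(1) numeral_2_eq_2 numeral_3_eq_3)
      then show False using acyc by blast
    qed
    have nw: "(w, w) \<notin> E" and wu: "(w, u) \<in> E"
      using irr uw(1) symE by (auto simp: irrefl_def dest: symD)
    have only': "u' = u" if "(w, u') \<in> E" "u' \<in> S" for u'
      using only[OF symD[OF symE that(1)] that(2)] .
    have eq: "E \<inter> insert w S \<times> insert w S = (E \<inter> S \<times> S) \<union> {(u, w), (w, u)}"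
    proof (intro equalityI subrelI)
      fix p q assume "(p, q) \<in> E \<inter> insert w S \<times> insert w S"
      then have pq: "(p, q) \<in> E" "p = w \<or> p \<in> S" "q = w \<or> q \<in> S" by auto
      have "p = w \<Longrightarrow> q = u" using pq nw only'[of q] by auto
      moreover have "q = w \<Longrightarrow> p = u" using pq nw only[of p] by auto
      ultimately show "(p, q) \<in> (E \<inter> S \<times> S) \<union> {(u, w), (w, u)}" using pq by auto
    qed (use uw wu in auto)
    have "tree (insert w S) ((E \<inter> S \<times> S) \<union> {(u, w), (w, u)})"
      using S uw by (blast intro: tree.leaf)
    then have "?Q (insert w S)" unfolding eq using S wV by blast
    then have "card (insert w S) \<le> card S" by (rule max)
    moreover have "finite S" using S fin by (blast intro: finite_subset)
    ultimately show False using uw(3) by simp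
  qed
  then show ?thesis using S EV by (simp add: Int_absorb2)
qed

section \<open>Stars and spiders\<close>

text \<open>A leg of a spider is the list of its vertices, starting at the neighbour of the centre \<open>c\<close>.\<close>

primrec arm :: "'a \<Rightarrow> 'a list \<Rightarrow> 'a rel" where
  "arm c [] = {}"
| "arm c (a # as) = {(c, a), (a, c)} \<union> arm a as"

text \<open>One \<open>distinct\<close> over the concatenation keeps the legs disjoint from each
  other and from \<open>c\<close>. Without empty legs, the number of legs is the degree of
  \<open>c\<close>.\<close>

definition spider :: "'a \<Rightarrow> 'a list list \<Rightarrow> 'a set \<Rightarrow> 'a rel \<Rightarrow> bool" where
  "spider c legs V E \<longleftrightarrow> distinct (c # concat legs) \<and> [] \<notin> set legs
     \<and> V = set (c # concat legs) \<and> E = (\<Union>l\<in>set legs. arm c l)"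

lemma tree_arm: "distinct (c # l) \<Longrightarrow> tree (set (c # l)) (arm c l)"
proof (induction l arbitrary: c)
  case Nil
  then show ?case by (simp add: tree.single)
next
  case (Cons a l)
  then have "tree ({c} \<union> set (a # l)) (link {} (arm a l) c a)"
    by (intro tree_link tree.single) auto
  then show ?case by (simp add: link_def insert_commute)
qed

lemma spider_Cons:
  assumes "spider c legs A EA" "distinct (w # l)" "A \<inter> set (w # l) = {}"
  shows "spider c ((w # l) # legs) (A \<union> set (w # l)) (link EA (arm w l) c w)"
  using assms unfolding spider_def link_def by auto

lemma tree_spider: "spider c legs V E \<Longrightarrow> tree V E"
proof (induction legs arbitrary: V E)
  case Nil
  then show ?case by (simp add: spider_def tree.single)
next
  case (Cons l legs)
  then obtain w k where l: "l = w # k" by (cases l) (auto simp: spider_def)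
  let ?A = "set (c # concat legs)" and ?E = "\<Union>l\<in>set legs. arm c l"
  have "spider c legs ?A ?E" using Cons.prems by (simp add: spider_def)
  then have "tree ?A ?E" by (rule Cons.IH)
  moreover have "tree (set (w # k)) (arm w k)" using Cons.prems l by (intro tree_arm) (simp add: spider_def)
  ultimately have "tree (?A \<union> set (w # k)) (link ?E (arm w k) c w)"
    using Cons.prems l by (intro tree_link) (auto simp: spider_def)
  moreover have "V = ?A \<union> set (w # k)" "E = link ?E (arm w k) c w"
    using Cons.prems l by (auto simp: spider_def link_def)
  ultimately show ?case by simp
qed

text \<open>Reordering allows the legs to be sorted by length and a chosen pair to be brought to the
  front.\<close>

lemma spider_mset:
  assumes "mset legs = mset legs'" "spider c legs V E" shows "spider c legs' V E"
proof -
  have s: "set legs = set legs'" using assms(1) by (rule mset_eq_setD)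
  have "mset (concat legs) = mset (concat legs')"
    by (simp add: mset_concat assms(1) flip: sum_mset_sum_list)
  then have "distinct (concat legs) = distinct (concat legs')" by (rule mset_eq_imp_distinct_iff)
  then show ?thesis using assms(2) s unfolding spider_def by simp
qed

text \<open>A centre would be an end of the middle edge \<open>qr\<close>, but then the outer edge
  at the other end of \<open>qr\<close> misses it.\<close>

lemma not_star_path:
  assumes "(p, q) \<in> E" "(q, r) \<in> E" "(r, s) \<in> E" "p \<noteq> r" "q \<noteq> s" "p \<noteq> s"
  shows "\<not> is_star V E"
  using assms unfolding is_star_def by auto

text \<open>If the centre lies in \<open>B\<close>, every other vertex of \<open>B\<close> has a
  neighbour in \<open>B\<close>, which must be the centre; otherwise \<open>B\<close> has no edge
  and is a single vertex. Conversely, a tree containing a non-star is no star.\<close>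

lemma is_star_subtree:
  assumes "is_star V E" "tree B EB" "B \<subseteq> V" "EB \<subseteq> E"
  shows "is_star B EB"
proof -
  obtain c where E: "E = {(u, v). u \<in> V \<and> v \<in> V \<and> u \<noteq> v \<and> (u = c \<or> v = c)}"
    using assms(1) unfolding is_star_def by blast
  have sub: "EB \<subseteq> B \<times> B" and sym: "sym EB"
    using assms(2) tree_edges_subset tree_sym by blast+
  show ?thesis
  proof (cases "c \<in> B")
    case True
    have "(u, c) \<in> EB \<and> (c, u) \<in> EB" if u: "u \<in> B" "u \<noteq> c" for u
    proof -
      obtain w where w: "(u, w) \<in> EB" using tree_neighbour[OF assms(2) u(1)] u True by blast
      then have "w = c" using assms(4) E u by auto
      then show ?thesis using w sym by (auto dest: symD)
    qed
    then have "EB = {(u, v). u \<in> B \<and> v \<in> B \<and> u \<noteq> v \<and> (u = c \<or> v = c)}"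
      using assms(4) E sub by auto
    then show ?thesis using True unfolding is_star_def by blast
  next
    case False
    then have "EB = {}" using assms(4) E sub by auto
    obtain u where u: "u \<in> B" using assms(2) tree_nonempty by blast
    then have "B = {u}" using tree_neighbour[OF assms(2) u] \<open>EB = {}\<close> by blast
    then show ?thesis using \<open>EB = {}\<close> unfolding is_star_def by auto
  qed
qed

text \<open>A path with four vertices is exhibited: along \<open>l\<close> from the centre, or from
  a second leg through the centre into \<open>l\<close>.\<close>

lemma spider_not_star:
  assumes "spider c legs V E" "l \<in> set legs" "length l \<ge> 2" "length l \<ge> 3 \<or> length legs \<ge> 2"
  shows "\<not> is_star V E"
proof -
  have E: "E = (\<Union>l\<in>set legs. arm c l)" and d: "distinct (c # concat legs)" and ne: "[] \<notin> set legs"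
    using assms(1) unfolding spider_def by auto
  obtain p q k where l: "l = p # q # k" using assms(3) by (cases l rule: remdups_adj.cases) auto
  have sub: "arm c l \<subseteq> E" using E assms(2) by blast
  have dl: "distinct (c # l)" using d assms(2) by (auto simp: distinct_concat_iff)
  show ?thesis using assms(4)
  proof
    assume "length l \<ge> 3"
    then obtain r k' where "k = r # k'" using l by (cases k) auto
    then show ?thesis using sub l dl by (intro not_star_path[of c p E q r]) auto
  next
    assume "length legs \<ge> 2"
    have "distinct legs" using d ne by (simp add: distinct_concat_iff removeAll_id)
    then have "card (set legs) \<ge> 2" using \<open>length legs \<ge> 2\<close> distinct_card by metis
    then have "\<not> set legs \<subseteq> {l}" using card_mono[of "{l}" "set legs"] by auto
    then obtain l' where l': "l' \<in> set legs" "l' \<noteq> l" by blast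
    then obtain w k' where w: "l' = w # k'" using ne by (metis neq_Nil_conv)
    have "set l \<inter> set l' = {}" using d assms(2) l' by (auto simp: distinct_concat_iff)
    moreover have "c \<noteq> w" using d l' w by auto
    moreover have "arm c l' \<subseteq> E" using E l' by blast
    ultimately show ?thesis using sub l w dl by (intro not_star_path[of w c E p q]) auto
  qed
qed

lemma spider_star:
  assumes "spider c legs V E" "\<forall>l\<in>set legs. length l \<le> 1"
  shows "is_star V E"
proof -
  have legs: "\<exists>a. l = [a]" if "l \<in> set legs" for l
    using assms that by (cases l) (auto simp: spider_def)
  have "(u, v) \<in> E \<longleftrightarrow> u \<in> V \<and> v \<in> V \<and> u \<noteq> v \<and> (u = c \<or> v = c)" for u v
  proof
    assume "(u, v) \<in> E"
    then obtain l a where "l \<in> set legs" "(u, v) \<in> arm c l" "l = [a]"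
      using assms(1) legs unfolding spider_def by blast
    then have "(u, v) \<in> {(c, a), (a, c)}" "a \<in> set (concat legs)" by force+
    then show "u \<in> V \<and> v \<in> V \<and> u \<noteq> v \<and> (u = c \<or> v = c)" using assms(1) unfolding spider_def by auto
  next
    assume h: "u \<in> V \<and> v \<in> V \<and> u \<noteq> v \<and> (u = c \<or> v = c)"
    have *: "(c, a) \<in> E \<and> (a, c) \<in> E" if a: "a \<in> V" "a \<noteq> c" for a
    proof -
      obtain l where "l \<in> set legs" "a \<in> set l" using a assms(1) unfolding spider_def by auto
      moreover from this have "l = [a]" using legs by fastforce
      ultimately have "arm c [a] \<subseteq> E" using assms(1) unfolding spider_def by blast
      then show ?thesis by simp
    qed
    show "(u, v) \<in> E" using * h by auto
  qed
  then have "E = {(u, v). u \<in> V \<and> v \<in> V \<and> u \<noteq> v \<and> (u = c \<or> v = c)}" by auto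
  moreover have "c \<in> V" using assms(1) unfolding spider_def by simp
  ultimately show ?thesis unfolding is_star_def by blast
qed

text \<open>The centre is the middle vertex \<open>a\<close>, not \<open>c\<close>. So a spider with
  a single leg of two vertices is a star as well.\<close>

lemma short_path_star: "is_star (set [c, a, b]) (arm c [a, b])" if "distinct [c, a, b]"
  unfolding is_star_def using that by (intro bexI[of _ a]) auto

text \<open>Any two vertices other than the centre \<open>z\<close> and \<open>w\<close> would be
  twins, so \<open>W\<close> has at most three vertices and is a path starting at \<open>w\<close>.
  The vertex \<open>w\<close> is exempt because in the ambient tree it has one more
  neighbour.\<close>

lemma star_is_arm:
  assumes "is_star W EW" "w \<in> W"
    and twins: "\<And>z a b. a \<noteq> w \<Longrightarrow> b \<noteq> w \<Longrightarrow> {u. (a, u) \<in> EW} = {z} \<Longrightarrow> {u. (b, u) \<in> EW} = {z} \<Longrightarrow> a = b"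
  shows "\<exists>l. distinct (w # l) \<and> W = set (w # l) \<and> EW = arm w l \<and> length l \<le> 2"
proof -
  obtain z where z: "z \<in> W" and EW: "EW = {(u, v). u \<in> W \<and> v \<in> W \<and> u \<noteq> v \<and> (u = z \<or> v = z)}"
    using assms(1) unfolding is_star_def by blast
  have nb: "{u. (a, u) \<in> EW} = {z}" if "a \<in> W" "a \<noteq> z" for a using that EW z by auto
  have uniq: "a = b" if "a \<in> W - {z, w}" "b \<in> W - {z, w}" for a b
    using twins[of a b z] nb that by blast
  show ?thesis
  proof (cases "W - {z, w} = {}")
    case True
    then have "W = {z, w}" using z assms(2) by blast
    then show ?thesis using EW
      by (intro exI[of _ "if w = z then [] else [z]"]) auto
  next
    case False
    then obtain a where "W - {z, w} = {a}" using uniq by blast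
    then have W: "W = {z, w, a}" "a \<noteq> z" "a \<noteq> w" using z assms(2) by auto
    show ?thesis
    proof (cases "w = z")
      case True
      then show ?thesis using W EW by (intro exI[of _ "[a]"]) auto
    next
      case False
      then show ?thesis using W EW by (intro exI[of _ "[z, a]"]) auto
    qed
  qed
qed

text \<open>Branches at \<open>c\<close> are cut off one at a time. Each is a path starting at a
  neighbour \<open>w\<close> of \<open>c\<close>, so it forms a leg of at most 1 + 2
  vertices.\<close>

lemma spider_of_branches:
  assumes "tree C EC" "c \<in> C"
    and "\<And>A EA w W EW. split C EC c w A EA W EW \<Longrightarrow>
      \<exists>l. distinct (w # l) \<and> W = set (w # l) \<and> EW = arm w l \<and> length l \<le> 2"
  shows "\<exists>legs. spider c legs C EC \<and> (\<forall>l\<in>set legs. length l \<le> 3)"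
  using assms
proof (induction "card C" arbitrary: C EC rule: less_induct)
  case less
  show ?case
  proof (cases "C = {c}")
    case True
    then have "EC = {}" using less.prems(1) tree_singleton[of c EC] by simp
    then show ?thesis using True by (intro exI[of _ "[]"]) (auto simp: spider_def)
  next
    case False
    then obtain w where "(c, w) \<in> EC" using tree_neighbour less.prems by metis
    then obtain A EA W EW where s: "split C EC c w A EA W EW" using tree_split less.prems by metis
    then have A: "tree A EA" "c \<in> A" "w \<in> W" "A \<inter> W = {}" "C = A \<union> W" "EC = link EA EW c w"
      by (auto simp: split_def)
    have "card A < card C"
      using A tree_finite[OF less.prems(1)] by (intro psubset_card_mono) auto
    moreover have "\<exists>l. distinct (w' # l) \<and> W' = set (w' # l) \<and> EW' = arm w' l \<and> length l \<le> 2"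
      if "split A EA c w' A' EA' W' EW'" for A' EA' w' W' EW'
      \<comment> \<open>A branch of the remaining tree \<open>A\<close> at \<open>c\<close> is a
        branch of \<open>C\<close> as well.\<close>
      using less.prems(3)[OF split_split[OF split_commute[OF s] that]] .
    ultimately obtain legs where legs: "spider c legs A EA" "\<forall>l\<in>set legs. length l \<le> 3"
      using less.hyps[of A EA] A by blast
    obtain l where l: "distinct (w # l)" "W = set (w # l)" "EW = arm w l" "length l \<le> 2"
      using less.prems(3)[OF s] by blast
    have "spider c ((w # l) # legs) C EC"
      using spider_Cons[OF legs(1) l(1)] A l by simp
    then show ?thesis using legs l by (intro exI[of _ "(w # l) # legs"]) auto
  qed
qed

section \<open>Matching legs with the tables of permutations\<close>

lemma legs_removable_out:
  assumes "1 \<le> length l1" "length l1 \<le> length l2" "length l2 \<le> 3"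
  shows "\<exists>par p. removable_out par p \<and> length par = Suc (length l1 + length l2)
    \<and> (\<forall>c. tree_edges (c # l1 @ l2) par = arm c l1 \<union> arm c l2)"
proof -
  consider a b where "l1 = [a]" "l2 = [b]" | a b d where "l1 = [a]" "l2 = [b, d]"
    | a b d e where "l1 = [a]" "l2 = [b, d, e]" | a b d e where "l1 = [a, b]" "l2 = [d, e]"
    | a b d e f where "l1 = [a, b]" "l2 = [d, e, f]"
    | a b d e f g where "l1 = [a, b, d]" "l2 = [e, f, g]"
    using assms
    by (auto simp: le_Suc_eq length_Suc_conv Suc_le_length_iff numeral_eq_Suc)
  then show ?thesis
  proof cases
    case 1
    then show ?thesis using removables(1) by (intro exI conjI) (assumption, auto simp: tree_edges_def)
  next
    case 2
    then show ?thesis using removables(3) by (intro exI conjI) (assumption, auto simp: tree_edges_def)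
  next
    case 3
    then show ?thesis using removables(5) by (intro exI conjI) (assumption, auto simp: tree_edges_def)
  next
    case 4
    then show ?thesis using removables(7) by (intro exI conjI) (assumption, auto simp: tree_edges_def)
  next
    case 5
    then show ?thesis using removables(9) by (intro exI conjI) (assumption, auto simp: tree_edges_def)
  next
    case 6
    then show ?thesis using removables(11) by (intro exI conjI) (assumption, auto simp: tree_edges_def)
  qed
qed

lemma legs_removable_in:
  assumes "1 \<le> length l1" "length l1 \<le> length l2" "length l2 \<le> 3" "length l1 \<le> 2"
  shows "\<exists>par ps. removable_in par ps \<and> length par = Suc (length l1 + length l2)
    \<and> (\<forall>c. tree_edges (c # l1 @ l2) par = arm c l1 \<union> arm c l2)"
proof -
  consider a b where "l1 = [a]" "l2 = [b]" | a b d where "l1 = [a]" "l2 = [b, d]"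
    | a b d e where "l1 = [a]" "l2 = [b, d, e]" | a b d e where "l1 = [a, b]" "l2 = [d, e]"
    | a b d e f where "l1 = [a, b]" "l2 = [d, e, f]"
    using assms
    by (auto simp: le_Suc_eq length_Suc_conv Suc_le_length_iff numeral_eq_Suc)
  then show ?thesis
  proof cases
    case 1
    then show ?thesis using removables(2) by (intro exI conjI) (assumption, auto simp: tree_edges_def)
  next
    case 2
    then show ?thesis using removables(4) by (intro exI conjI) (assumption, auto simp: tree_edges_def)
  next
    case 3
    then show ?thesis using removables(6) by (intro exI conjI) (assumption, auto simp: tree_edges_def)
  next
    case 4
    then show ?thesis using removables(8) by (intro exI conjI) (assumption, auto simp: tree_edges_def)
  next
    case 5
    then show ?thesis using removables(10) by (intro exI conjI) (assumption, auto simp: tree_edges_def)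
  qed
qed

lemma small_spider:
  assumes "map length legs \<in> {[3], [1,2], [1,3], [2,2], [2,3], [3,3], [1,1,2], [1,2,2], [2,2,2]}"
  shows "\<exists>par ps. small_tree par ps \<and> length par = Suc (length (concat legs))
    \<and> (\<forall>c. tree_edges (c # concat legs) par = (\<Union>l\<in>set legs. arm c l))"
proof -
  consider a b d where "legs = [[a, b, d]]" | a b d where "legs = [[a], [b, d]]"
    | a b d e where "legs = [[a], [b, d, e]]" | a b d e where "legs = [[a, b], [d, e]]"
    | a b d e f where "legs = [[a, b], [d, e, f]]"
    | a b d e f g where "legs = [[a, b, d], [e, f, g]]"
    | a b d e where "legs = [[a], [b], [d, e]]"
    | a b d e f where "legs = [[a], [b, d], [e, f]]"
    | a b d e f g where "legs = [[a, b], [d, e], [f, g]]"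
    using assms by (auto simp: map_eq_Cons_conv length_Suc_conv numeral_eq_Suc)
  then show ?thesis
  proof cases
    case 1
    then show ?thesis using small_trees(1) by (intro exI conjI) (assumption, auto simp: tree_edges_def)
  next
    case 2
    then show ?thesis using small_trees(2) by (intro exI conjI) (assumption, auto simp: tree_edges_def)
  next
    case 3
    then show ?thesis using small_trees(3) by (intro exI conjI) (assumption, auto simp: tree_edges_def)
  next
    case 4
    then show ?thesis using small_trees(4) by (intro exI conjI) (assumption, auto simp: tree_edges_def)
  next
    case 5
    then show ?thesis using small_trees(5) by (intro exI conjI) (assumption, auto simp: tree_edges_def)
  next
    case 6
    then show ?thesis using small_trees(6) by (intro exI conjI) (assumption, auto simp: tree_edges_def)
  next
    case 7
    then show ?thesis using small_trees(7) by (intro exI conjI) (assumption, auto simp: tree_edges_def)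
  next
    case 8
    then show ?thesis using small_trees(8) by (intro exI conjI) (assumption, auto simp: tree_edges_def)
  next
    case 9
    then show ?thesis using small_trees(9) by (intro exI conjI) (assumption, auto simp: tree_edges_def)
  qed
qed

section \<open>The induction\<close>

lemma spider_remove_legs:
  fixes V :: "'a set"
  assumes sp: "spider c (l1 # l2 # rest) V E" and len: "length l1 \<le> length l2" "length l2 \<le> 3"
    and x: "x \<in> V" "length l1 \<le> 2 \<or> x \<notin> set (l1 @ l2)"
    and ns: "\<not> is_star (set (c # concat rest)) (\<Union>l\<in>set rest. arm c l)"
    and IH: "\<And>(V' :: 'a set) E' y. tree V' E' \<Longrightarrow> \<not> is_star V' E' \<Longrightarrow> card V' < card V \<Longrightarrow> y \<in> V' \<Longrightarrow>
      \<exists>\<sigma>. placement V' E' y \<sigma>"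
  shows "\<exists>\<sigma>. placement V E x \<sigma>"
proof -
  let ?A = "set (c # concat rest)" and ?EA = "\<Union>l\<in>set rest. arm c l"
  have spA: "spider c rest ?A ?EA" using sp unfolding spider_def by simp
  note tA = tree_spider[OF spA]
  have l1: "1 \<le> length l1" using sp unfolding spider_def by (cases l1) auto
  have V: "V = ?A \<union> set (l1 @ l2)" and E: "E = ?EA \<union> (arm c l1 \<union> arm c l2)"
    and d: "distinct (c # l1 @ l2)" and disj: "?A \<inter> set (l1 @ l2) = {}"
    using sp unfolding spider_def by auto
  have "hd l1 \<in> V - ?A" using l1 V disj by (cases l1) auto
  then have "card ?A < card V" using V by (intro psubset_card_mono) auto
  then have pA: "\<exists>\<sigma>. placement ?A ?EA y \<sigma>" if "y \<in> ?A" for y using IH[OF tA ns] that by blast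
  show ?thesis
  proof (cases "x \<in> ?A")
    case True
    obtain par p where p: "removable_out par p" "length par = Suc (length l1 + length l2)"
      "\<And>c. tree_edges (c # l1 @ l2) par = arm c l1 \<union> arm c l2"
      using legs_removable_out[OF l1 len] by blast
    show ?thesis
      using placement_removable_out[OF d _ p(1) tree_edges_subset[OF tA] tree_sym[OF tA] disj _ True pA[OF True]]
        p(2,3) V E by simp
  next
    case False
    then have xR: "x \<in> set (l1 @ l2)" using x(1) V by blast
    then obtain par ps where p: "removable_in par ps" "length par = Suc (length l1 + length l2)"
      "\<And>c. tree_edges (c # l1 @ l2) par = arm c l1 \<union> arm c l2"
      using legs_removable_in[OF l1 len] x(2) by blast
    show ?thesis
      using placement_removable_in[OF d _ p(1) tree_edges_subset[OF tA] tree_sym[OF tA] disj _ xR pA]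
        p(2,3) V E by simp
  qed
qed

text \<open>With the legs sorted by length, the two shortest are removed as long as the remaining
  ones still form a non-star. This fails only for at most two legs, or for three legs of at most two
  vertices; stars excepted, these are the nine cases of \<open>small_spider\<close>.\<close>

lemma spider_placement:
  fixes V :: "'a set"
  assumes sp: "spider c legs V E" and len: "\<forall>l\<in>set legs. length l \<le> 3"
    and ns: "\<not> is_star V E" and x: "x \<in> V"
    and IH: "\<And>(V' :: 'a set) E' y. tree V' E' \<Longrightarrow> \<not> is_star V' E' \<Longrightarrow> card V' < card V \<Longrightarrow> y \<in> V' \<Longrightarrow>
      \<exists>\<sigma>. placement V' E' y \<sigma>"
  shows "\<exists>\<sigma>. placement V E x \<sigma>"
proof -
  define ls where "ls = sort_key length legs"
  have sp': "spider c ls V E" using spider_mset[OF _ sp] by (simp add: ls_def)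
  have len': "\<And>l. l \<in> set ls \<Longrightarrow> 1 \<le> length l \<and> length l \<le> 3"
    using len sp by (auto simp: ls_def spider_def Suc_le_eq)
  have sorted: "sorted (map length ls)" by (simp add: ls_def)
  have long: "\<exists>l\<in>set ls. 2 \<le> length l" using spider_star[OF sp'] ns by force
  have small: ?thesis
    if s: "map length ls \<in> {[3], [1,2], [1,3], [2,2], [2,3], [3,3], [1,1,2], [1,2,2], [2,2,2]}"
  proof -
    obtain par ps where p: "small_tree par ps" "length par = Suc (length (concat ls))"
      "\<And>c. tree_edges (c # concat ls) par = (\<Union>l\<in>set ls. arm c l)"
      using small_spider[OF s] by blast
    have "\<exists>\<sigma>. placement (set (c # concat ls)) (tree_edges (c # concat ls) par) x \<sigma>"
      using sp' x p by (intro placement_small_tree[OF _ _ p(1)]) (auto simp: spider_def)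
    then show ?thesis using sp' p(3) unfolding spider_def by simp
  qed
  have big: ?thesis
    if ls: "ls = l1 # l2 # l3 # rest" and l3: "length l3 = 3 \<or> rest \<noteq> []" for l1 l2 l3 rest
  proof -
    have le: "length l1 \<le> length l2" "\<And>l. l \<in> set (l3 # rest) \<Longrightarrow> length l2 \<le> length l"
      using sorted ls by auto
    have keep: "\<not> is_star (set (c # concat k)) (\<Union>l\<in>set k. arm c l)"
      if k: "spider c (k1 # k2 # k) V E" and "l \<in> set k" "2 \<le> length l" "3 \<le> length l \<or> 2 \<le> length k"
      for k1 k2 k l
      using k that(2-4) by (intro spider_not_star[of c k _ _ l]) (auto simp: spider_def)
    show ?thesis
    proof (cases "length l1 = 3")
      \<comment> \<open>As \<open>l1\<close> has at most two vertices, \<open>l1\<close> and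
        \<open>l2\<close> can be removed wherever \<open>x\<close> lies. The longest leg is last and
        stays.\<close>
      case False
      have "length (last (l3 # rest)) \<ge> length l" if "l \<in> set ls" for l
      proof -
        have "sorted (map length (l3 # rest))" using sorted ls by simp
        then have "\<And>l. l \<in> set (l3 # rest) \<Longrightarrow> length l \<le> length (last (l3 # rest))"
          by (induction rest arbitrary: l3) auto
        moreover have "last (l3 # rest) \<in> set (l3 # rest)" by simp
        ultimately show ?thesis using that ls le by fastforce
      qed
      then have "2 \<le> length (last (l3 # rest))" using long by fastforce
      moreover have "3 \<le> length (last (l3 # rest)) \<or> 2 \<le> length (l3 # rest)"
        using l3 by (cases rest) auto
      ultimately have "\<not> is_star (set (c # concat (l3 # rest))) (\<Union>l\<in>set (l3 # rest). arm c l)"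
        using keep[of l1 l2 "l3 # rest" "last (l3 # rest)"] sp' ls by simp
      moreover have "length l1 \<le> 2" "length l2 \<le> 3" using False len'[of l1] len'[of l2] ls by auto
      ultimately show ?thesis
        using spider_remove_legs[OF sp'[unfolded ls] le(1) _ x _ _ IH] by simp
    next
      case True
      then have three: "length l2 = 3" "length l3 = 3"
        using le len'[of l2] len'[of l3] ls by force+
      \<comment> \<open>Now every leg has three vertices. At most one of the first three contains
        \<open>x\<close>, so two of them avoid it and can be removed, while the third keeps the rest
        from being a star.\<close>
      have rm: ?thesis
        if m: "mset ls = mset (k1 # k2 # k3 # k)" and k: "length k1 = 3" "length k2 = 3" "length k3 = 3"
          "x \<notin> set (k1 @ k2)" for k1 k2 k3 k
      proof -
        have sk: "spider c (k1 # k2 # k3 # k) V E" using spider_mset[OF m sp'] .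
        show ?thesis
          using spider_remove_legs[OF sk _ _ x _ keep[OF sk, of k3] IH] k by simp
      qed
      have d: "set l1 \<inter> set l2 = {}" "set l1 \<inter> set l3 = {}" "set l2 \<inter> set l3 = {}"
        using sp' ls unfolding spider_def by auto
      consider "x \<notin> set l1" "x \<notin> set l2" | "x \<in> set l1" | "x \<in> set l2" by blast
      then show ?thesis
      proof cases
        case 1
        then show ?thesis using rm[of l1 l2 l3 rest] ls True three by simp
      next
        case 2
        then have "x \<notin> set (l2 @ l3)" using d by auto
        then show ?thesis using rm[of l2 l3 l1 rest] ls True three by (simp add: add_mset_commute)
      next
        case 3
        then have "x \<notin> set (l1 @ l3)" using d by auto
        then show ?thesis using rm[of l1 l3 l2 rest] ls True three by (simp add: add_mset_commute)
      qed
    qed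
  qed
  have val: "\<And>l. l \<in> set ls \<Longrightarrow> length l = 1 \<or> length l = 2 \<or> length l = 3"
    using len' by fastforce
  consider "ls = []" | l1 where "ls = [l1]" | l1 l2 where "ls = [l1, l2]"
    | l1 l2 l3 rest where "ls = l1 # l2 # l3 # rest"
    by (metis neq_Nil_conv)
  then show ?thesis
  proof cases
    case 1
    then show ?thesis using long by simp
  next
    case (2 l1)
    show ?thesis
    proof (cases "length l1 = 2")
      case True
      then obtain a b where "l1 = [a, b]" by (auto simp: length_Suc_conv numeral_2_eq_2)
      then have "V = set [c, a, b]" "E = arm c [a, b]" "distinct [c, a, b]"
        using sp' 2 unfolding spider_def by auto
      then show ?thesis using short_path_star ns by metis
    next
      case False
      then show ?thesis using small long val[of l1] 2 by auto
    qed
  next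
    case (3 l1 l2)
    then show ?thesis using small long val[of l1] val[of l2] sorted by auto
  next
    case (4 l1 l2 l3 rest)
    show ?thesis
    proof (cases "length l3 = 3 \<or> rest \<noteq> []")
      case True
      then show ?thesis using big 4 by blast
    next
      case False
      then show ?thesis using small long val[of l1] val[of l2] val[of l3] sorted 4 by auto
    qed
  qed
qed

section \<open>Twin leaves\<close>

lemma remove_twins:
  fixes V :: "'a set"
  assumes t: "tree V E" and ab: "a \<noteq> b" "{u. (a, u) \<in> E} = {v}" "{u. (b, u) \<in> E} = {v}" and x: "x \<in> V"
    and ns: "\<not> is_star (V - {a, b}) (E - {(v, a), (a, v), (v, b), (b, v)})"
    and IH: "\<And>(V' :: 'a set) E' y. tree V' E' \<Longrightarrow> \<not> is_star V' E' \<Longrightarrow> card V' < card V \<Longrightarrow> y \<in> V' \<Longrightarrow>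
      \<exists>\<sigma>. placement V' E' y \<sigma>"
  shows "\<exists>\<sigma>. placement V E x \<sigma>"
proof -
  let ?V = "V - {a, b}" and ?E = "E - {(v, a), (a, v), (v, b), (b, v)}"
  have av: "(a, v) \<in> E" "(b, v) \<in> E" using ab by auto
  then have va: "(v, a) \<in> E" "(v, b) \<in> E" using symD[OF tree_sym[OF t]] by auto
  have inV: "a \<in> V" "b \<in> V" "v \<in> V" using av tree_edges_subset[OF t] by auto
  have vn: "v \<noteq> a" "v \<noteq> b" using av tree_irrefl[OF t] by auto
  \<comment> \<open>Deleting \<open>a\<close> leaves \<open>b\<close> a leaf at \<open>v\<close>, so
    \<open>tree_remove_leaf\<close> applies twice.\<close>
  have "{u. (b, u) \<in> E - {(v, a), (a, v)}} = {v}" using ab vn by auto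
  then have "tree (V - {a} - {b}) (E - {(v, a), (a, v)} - {(v, b), (b, v)})"
    using inV ab(1) by (intro tree_remove_leaf t ab) auto
  moreover have "V - {a} - {b} = ?V" "E - {(v, a), (a, v)} - {(v, b), (b, v)} = ?E" by auto
  ultimately have tA: "tree ?V ?E" by simp
  have "card ?V < card V" using inV tree_finite[OF t] by (intro psubset_card_mono) auto
  then have p: "\<exists>\<sigma>. placement ?V ?E y \<sigma>" if "y \<in> ?V" for y using IH[OF tA ns] that by blast
  have V: "V = ?V \<union> set [a, b]" using inV by auto
  have E: "E = ?E \<union> tree_edges [v, a, b] [0, 0, 0]" using av va by (auto simp: tree_edges_def)
  have d: "distinct [v, a, b]" using vn ab by auto
  show ?thesis
  proof (cases "x \<in> ?V")
    case True
    then show ?thesis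
      using placement_removable_out[OF d _ removables(1) tree_edges_subset[OF tA] tree_sym[OF tA] _ _ True p]
        V E inV vn by auto
  next
    case False
    then have "x \<in> set [a, b]" using x by auto
    then show ?thesis
      using placement_removable_in[OF d _ removables(2) tree_edges_subset[OF tA] tree_sym[OF tA] _ _ _ p]
        V E inV vn by auto
  qed
qed

text \<open>Suppose that removing the twins leaves a star with centre \<open>z\<close>. Then
  \<open>z \<noteq> v\<close>, since otherwise the whole tree is a star, and the tree consists of
  the edge \<open>vz\<close>, the leaves \<open>a\<close>, \<open>b\<close> at \<open>v\<close> and
  the leaves \<open>M\<close> at \<open>z\<close>. If \<open>M\<close> is empty this is a star at
  \<open>v\<close>; one or two elements give two small trees; from three on, two twins at
  \<open>z\<close> are removed instead.\<close>

lemma twins_placement: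
  fixes V :: "'a set"
  assumes t: "tree V E" and ab: "a \<noteq> b" "{u. (a, u) \<in> E} = {v}" "{u. (b, u) \<in> E} = {v}" and x: "x \<in> V"
    and ns: "\<not> is_star V E"
    and IH: "\<And>(V' :: 'a set) E' y. tree V' E' \<Longrightarrow> \<not> is_star V' E' \<Longrightarrow> card V' < card V \<Longrightarrow> y \<in> V' \<Longrightarrow>
      \<exists>\<sigma>. placement V' E' y \<sigma>"
  shows "\<exists>\<sigma>. placement V E x \<sigma>"
proof (cases "is_star (V - {a, b}) (E - {(v, a), (a, v), (v, b), (b, v)})")
  case False
  then show ?thesis by (rule remove_twins[OF t ab x _ IH])
next
  case True
  let ?V = "V - {a, b}" and ?E = "E - {(v, a), (a, v), (v, b), (b, v)}"
  have av: "(a, v) \<in> E" "(b, v) \<in> E" using ab by auto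
  then have va: "(v, a) \<in> E" "(v, b) \<in> E" using symD[OF tree_sym[OF t]] by auto
  have inV: "a \<in> V" "b \<in> V" "v \<in> V" using av tree_edges_subset[OF t] by auto
  have vn: "v \<noteq> a" "v \<noteq> b" using av tree_irrefl[OF t] by auto
  obtain z where z: "z \<in> ?V" and E': "?E = {(p, q). p \<in> ?V \<and> q \<in> ?V \<and> p \<noteq> q \<and> (p = z \<or> q = z)}"
    using True unfolding is_star_def by blast
  define M where "M = ?V - {z, v}"
  have E: "E = ?E \<union> {(v, a), (a, v), (v, b), (b, v)}" using av va by auto
  have zv: "z \<noteq> v"
  proof
    assume "z = v"
    then have "E = {(p, q). p \<in> V \<and> q \<in> V \<and> p \<noteq> q \<and> (p = v \<or> q = v)}"
      using E E' inV vn by auto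
    then show False using ns inV unfolding is_star_def by blast
  qed
  have V: "V = {v, z, a, b} \<union> M" using inV z vn unfolding M_def by auto
  have Mn: "v \<notin> M" "z \<notin> M" "a \<notin> M" "b \<notin> M" unfolding M_def by auto
  have za: "z \<noteq> a" "z \<noteq> b" using z by auto
  have EM: "E = (\<Union>p\<in>insert v M. {(z, p), (p, z)}) \<union> {(v, a), (a, v), (v, b), (b, v)}"
  proof -
    have "?V = insert z (insert v M)" using V Mn vn za by auto
    then have "?E = (\<Union>p\<in>insert v M. {(z, p), (p, z)})" unfolding E' using zv Mn by auto
    then show ?thesis using E by simp
  qed
  have leafM: "{u. (d, u) \<in> E} = {z}" if "d \<in> M" for d unfolding EM using that Mn zv za by auto
  have d0: "distinct [v, z, a, b]" using zv za vn ab by auto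
  consider "M = {}" | d where "M = {d}" | d e where "M = {d, e}" "d \<noteq> e"
    | d e f where "d \<in> M" "e \<in> M" "f \<in> M" "d \<noteq> e" "f \<noteq> d" "f \<noteq> e"
  proof -
    have "M = {} \<or> (\<exists>d\<in>M. M = {d}) \<or> (\<exists>d\<in>M. \<exists>e\<in>M. d \<noteq> e)" by blast
    moreover have "M = {d, e} \<or> (\<exists>f\<in>M. f \<noteq> d \<and> f \<noteq> e)" if "d \<in> M" "e \<in> M" for d e
      using that by blast
    ultimately show thesis using that by metis
  qed
  then show ?thesis
  proof cases
    case 1
    then have "E = {(p, q). p \<in> V \<and> q \<in> V \<and> p \<noteq> q \<and> (p = v \<or> q = v)}"
      unfolding EM V using d0 by auto
    then show ?thesis using ns inV unfolding is_star_def by blast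
  next
    case (2 d)
    have "E = tree_edges [v, a, b, z, d] [0,0,0,0,3]" unfolding EM 2 by (auto simp: tree_edges_def)
    moreover have "V = set [v, a, b, z, d]" unfolding V 2 by auto
    ultimately show ?thesis
      using placement_small_tree[OF _ _ small_trees(7), of "[v, a, b, z, d]" x] x d0 Mn 2 by auto
  next
    case (3 d e)
    have "E = tree_edges [v, z, a, b, d, e] [0,0,0,0,1,1]" unfolding EM 3 by (auto simp: tree_edges_def)
    moreover have "V = set [v, z, a, b, d, e]" unfolding V 3 by auto
    ultimately show ?thesis
      using placement_small_tree[OF _ _ small_trees(10), of "[v, z, a, b, d, e]" x] x d0 Mn 3 by auto
  next
    case (4 d e f)
    \<comment> \<open>The path \<open>a v z f\<close> remains.\<close>
    have "\<not> is_star (V - {d, e}) (E - {(z, d), (d, z), (z, e), (e, z)})"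
      by (rule not_star_path[of a v _ z f]) (use 4 Mn d0 in \<open>auto simp: EM\<close>)
    then show ?thesis using remove_twins[OF t 4(4) leafM[OF 4(1)] leafM[OF 4(2)] x _ IH] by blast
  qed
qed

section \<open>The induction over all trees\<close>

lemma split_neighbours:
  "split V E a b A EA B EB \<Longrightarrow> p \<noteq> b \<Longrightarrow> {u. (p, u) \<in> EB} = {z} \<Longrightarrow> {u. (p, u) \<in> E} = {z}"
proof -
  assume s: "split V E a b A EA B EB" and p: "p \<noteq> b" "{u. (p, u) \<in> EB} = {z}"
  have "p \<in> B" using s p(2) tree_edges_subset[of B EB] unfolding split_def by blast
  then have "p \<notin> A" "p \<noteq> a" using s unfolding split_def by auto
  moreover have "EA \<subseteq> A \<times> A" using s tree_edges_subset[of A EA] unfolding split_def by blast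
  ultimately show ?thesis using s p unfolding split_def link_def by auto
qed

lemma tree_placement:
  fixes V :: "'a set"
  assumes "tree V E" "\<not> is_star V E" "x \<in> V"
  shows "\<exists>\<sigma>. placement V E x \<sigma>"
  using assms
proof (induction "card V" arbitrary: V E x rule: less_induct)
  case less
  note t = less.prems(1) and ns = less.prems(2) and x = less.prems(3)
  have IH: "\<exists>\<sigma>. placement V' E' y \<sigma>"
    if "tree V' E'" "\<not> is_star V' E'" "card V' < card V" "y \<in> V'" for V' :: "'a set" and E' y
    using less.hyps that by blast
  show ?case
  proof (cases "\<exists>a b v. a \<noteq> b \<and> {u. (a, u) \<in> E} = {v} \<and> {u. (b, u) \<in> E} = {v}")
    case True
    then obtain a b v where "a \<noteq> b" "{u. (a, u) \<in> E} = {v}" "{u. (b, u) \<in> E} = {v}" by blast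
    then show ?thesis by (rule twins_placement[OF t _ _ _ x ns IH])
  next
    case False
    \<comment> \<open>Apart from \<open>w\<close>, leaves of a side keep their neighbours in
      \<open>V\<close>, where no twins exist. Hence a side that is a star is a path starting at
      \<open>w\<close>.\<close>
    have arm: "\<exists>l. distinct (w # l) \<and> W = set (w # l) \<and> EW = arm w l \<and> length l \<le> 2"
      if s: "split V E c w A EA W EW" and W: "is_star W EW" for c w A EA W EW
    proof (rule star_is_arm[OF W])
      show "w \<in> W" using s unfolding split_def by blast
      fix z a b assume "a \<noteq> w" "b \<noteq> w" "{u. (a, u) \<in> EW} = {z}" "{u. (b, u) \<in> EW} = {z}"
      then show "a = b" using False split_neighbours[OF s] by metis
    qed
    \<comment> \<open>Requiring \<open>x \<in> A\<close> ensures that parts later removed from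
      \<open>B\<close> never contain \<open>x\<close>, so \<open>removable_out\<close> suffices,
      even for two legs of three vertices.\<close>
    define P where "P B \<longleftrightarrow> (\<exists>a b A EA EB. split V E a b A EA B EB \<and> x \<in> A \<and> \<not> is_star B EB)" for B
    show ?thesis
    proof (cases "\<exists>B. P B")
      case False
      have "\<exists>l. distinct (w # l) \<and> W = set (w # l) \<and> EW = arm w l \<and> length l \<le> 2"
        if s: "split V E x w A EA W EW" for w A EA W EW
      proof (rule arm[OF s])
        have "x \<in> A" using s unfolding split_def by blast
        then show "is_star W EW" using False s unfolding P_def by blast
      qed
      then obtain legs where "spider x legs V E" "\<forall>l\<in>set legs. length l \<le> 3"
        using spider_of_branches[OF t x] by blast
      then show ?thesis by (rule spider_placement[OF _ _ ns x IH])
    next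
      case True
      then obtain B where B: "P B" and min: "\<And>B'. P B' \<Longrightarrow> card B \<le> card B'"
        using ex_has_least_nat[of P _ card] by blast
      obtain a b A EA EB where s: "split V E a b A EA B EB" and xA: "x \<in> A" and nsB: "\<not> is_star B EB"
        using B unfolding P_def by blast
      have tA: "tree A EA" and tB: "tree B EB" and ab: "a \<in> A" "b \<in> B" and disj: "A \<inter> B = {}"
        and V: "V = A \<union> B" and E: "E = link EA EB a b"
        using s unfolding split_def by auto
      have "\<exists>l. distinct (w # l) \<and> W = set (w # l) \<and> EW = arm w l \<and> length l \<le> 2"
        if sB: "split B EB b w B' EB' W EW" for B' EB' w W EW
      proof -
        note s' = split_split[OF s sB]
        \<comment> \<open>The branch \<open>W\<close> misses \<open>b\<close>, hence is smaller than
          \<open>B\<close>, and \<open>x\<close> is on the other side of its edge. By minimality of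
          \<open>B\<close> it is a star.\<close>
        have "W \<subset> B" using sB unfolding split_def by blast
        then have "card W < card B" using tree_finite[OF tB] by (rule psubset_card_mono[rotated])
        then have "\<not> P W" using min by (meson not_le)
        then have "is_star W EW" using s' xA unfolding P_def by blast
        then show ?thesis by (rule arm[OF s'])
      qed
      then obtain legs where sp: "spider b legs B EB" and len: "\<forall>l\<in>set legs. length l \<le> 3"
        using spider_of_branches[OF tB ab(2)] by blast
      show ?thesis
      proof (cases "is_star A EA")
        case True
        \<comment> \<open>The cut read from the other side: a star \<open>A\<close> is a path
          starting at \<open>a\<close>, that is, one more leg at \<open>b\<close>.\<close>
        obtain l where l: "distinct (a # l)" "A = set (a # l)" "EA = arm a l" "length l \<le> 2"
          using arm[OF split_commute[OF s] True] by blast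
        have "spider b ((a # l) # legs) V E"
          using spider_Cons[OF sp l(1)] l disj V E link_commute[of EA EB a b] by (simp add: Un_commute Int_commute)
        moreover have "\<forall>l\<in>set ((a # l) # legs). length l \<le> 3" using l len by simp
        ultimately show ?thesis by (rule spider_placement[OF _ _ ns x IH])
      next
        case nsA: False
        have pair: ?thesis
          if k: "spider b (l1 # l2 # rest) B EB" "length l1 \<le> length l2" "length l2 \<le> 3" for l1 l2 rest
        proof -
          let ?C = "set (b # concat rest)" and ?EC = "\<Union>l\<in>set rest. arm b l"
          let ?A = "A \<union> ?C" and ?EA = "link EA ?EC a b"
          have l1: "1 \<le> length l1" using k(1) unfolding spider_def by (cases l1) auto
          have B: "B = ?C \<union> set (l1 @ l2)" and EB: "EB = ?EC \<union> (arm b l1 \<union> arm b l2)"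
            and d: "distinct (b # l1 @ l2)" and dC: "?C \<inter> set (l1 @ l2) = {}"
            using k(1) unfolding spider_def by auto
          have "spider b rest ?C ?EC" using k(1) unfolding spider_def by simp
          then have tC: "tree ?C ?EC" by (rule tree_spider)
          have "A \<inter> ?C = {}" using disj B by blast
          then have tA': "tree ?A ?EA" using ab by (intro tree_link[OF tC tA]) auto
          have dA: "?A \<inter> set (l1 @ l2) = {}" using disj B dC by blast
          have V': "V = ?A \<union> set (l1 @ l2)" unfolding V B by blast
          have E': "E = ?EA \<union> (arm b l1 \<union> arm b l2)" unfolding E EB link_def by blast
          \<comment> \<open>What remains contains the non-star \<open>A\<close>.\<close>
          have "\<not> is_star ?A ?EA"
            using nsA is_star_subtree[OF _ tA, of ?A ?EA] unfolding link_def by blast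
          moreover have "hd l1 \<in> V - ?A" using l1 V' dA by (cases l1) auto
          then have "card ?A < card V" using V' tree_finite[OF t] by (intro psubset_card_mono) auto
          ultimately have p: "\<exists>\<sigma>. placement ?A ?EA x \<sigma>" using xA by (intro IH tA') auto
          obtain par q where q: "removable_out par q" "length par = Suc (length l1 + length l2)"
            "\<And>c. tree_edges (c # l1 @ l2) par = arm c l1 \<union> arm c l2"
            using legs_removable_out[OF l1 k(2,3)] by blast
          have "\<exists>\<sigma>. placement (?A \<union> set (l1 @ l2)) (?EA \<union> tree_edges (b # l1 @ l2) par) x \<sigma>"
            by (rule placement_removable_out[OF d _ q(1) tree_edges_subset[OF tA'] tree_sym[OF tA'] dA _ _ p])
              (use q(2) xA in auto)
          then show ?thesis unfolding V' E' q(3) .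
        qed
        consider "legs = []" | l where "legs = [l]" | l1 l2 rest where "legs = l1 # l2 # rest"
          by (metis neq_Nil_conv)
        then show ?thesis
        proof cases
          case 1
          then show ?thesis using spider_star[OF sp] nsB by simp
        next
          case (2 l)
          have "length l \<noteq> 2"
          proof
            assume "length l = 2"
            then obtain p q where "l = [p, q]" by (auto simp: length_Suc_conv numeral_2_eq_2)
            then have "B = set [b, p, q]" "EB = arm b [p, q]" "distinct [b, p, q]"
              using sp 2 unfolding spider_def by auto
            then show False using short_path_star nsB by metis
          qed
          moreover have "\<not> length l \<le> 1" using spider_star[OF sp] nsB 2 by auto
          ultimately have "length l = 3" using len 2 by fastforce
          then obtain p q r where l: "l = [p, q, r]" by (auto simp: length_Suc_conv numeral_3_eq_3)
          have B: "B = set [b, p, q, r]" and EB: "EB = arm b [p, q, r]" and d: "distinct [b, p, q, r]"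
            using sp 2 l unfolding spider_def by auto
          have dA: "A \<inter> set [b, p, q, r] = {}" using disj B by simp
          \<comment> \<open>With one leg of three vertices, \<open>B\<close> is a pendant path of
            four vertices. It is removed as a whole, so the attachment vertex is now
            \<open>a\<close> rather than \<open>b\<close>.\<close>
          have "card A < card V" using V disj ab(2) tree_finite[OF t] by (intro psubset_card_mono) auto
          then have p: "\<exists>\<sigma>. placement A EA x \<sigma>" using xA nsA by (intro IH tA) auto
          have d': "distinct (a # [b, p, q, r])" using d dA ab(1) by auto
          have "\<exists>\<sigma>. placement (A \<union> set [b, p, q, r]) (EA \<union> tree_edges [a, b, p, q, r] [0,0,1,2,3]) x \<sigma>"
            by (rule placement_removable_out[OF d' _ removables(12) tree_edges_subset[OF tA] tree_sym[OF tA] dA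
              ab(1) xA p]) simp
          moreover have "E = EA \<union> tree_edges [a, b, p, q, r] [0,0,1,2,3]"
            unfolding E EB link_def by (auto simp: tree_edges_def)
          ultimately show ?thesis using V B by simp
        next
          case (3 l1 l2 rest)
          show ?thesis
          proof (cases "length l1 \<le> length l2")
            case True
            then show ?thesis using pair[of l1 l2 rest] sp len 3 by simp
          next
            case False
            have "spider b (l2 # l1 # rest) B EB"
              by (rule spider_mset[OF _ sp]) (simp add: 3 add_mset_commute)
            then show ?thesis using pair[of l2 l1 rest] len 3 False by simp
          qed
        qed
      qed
    qed
  qed
qed

theorem theorem1p7:
  fixes V :: "'a set" and E :: "'a rel" and x :: 'a
  assumes "is_tree V E" and "\<not> is_star V E" and "x \<in> V"
  shows "\<exists>\<sigma>. well_2_placement V E x \<sigma>"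
proof -
  have t: "tree V E" using assms(1) by (rule tree_of_is_tree)
  obtain \<sigma> where "placement V E x \<sigma>" using tree_placement[OF t assms(2,3)] by blast
  then show ?thesis
    by (rule well_2_placement_of_placement[OF _ tree_edges_subset[OF t] assms(3)])
qed

end
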